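(* Let $F$ be a fixed graph with $\chi(F)=r+1\ge 4$ and $a(F)=1$. Then, as $n\to\infty$, uniformly for integers $\Delta$ with $\lceil (r-1)n/r\rceil\le\Delta\le n-1$, $$\mathrm{ex}_F(n,\Delta)=e(S_{n,\Delta}^{(r)})+o(n^2)=(1+o(1))\,e(S_{n,\Delta}^{(r)}),$$ and $$\mathrm{spex}_F(n,\Delta)=\rho(S_{n,\Delta}^{(r)})+o(n)=(1+o(1))\,\rho(S_{n,\Delta}^{(r)}).$$
   Context: All graphs are finite, simple and undirected. A graph is $F$-free if it contains no copy of $F$ as a (not necessarily induced) subgraph. $e(G)$ is the number of edges, $\Delta(G)$ the maximum degree, $\chi$ the chromatic number, and $\rho(G)$ the adjacency spectral radius. For a graph $F$ with $\chi(F)=r+1\ge3$, $a(F):=\min\{|I|: I\subseteq V(F)\text{ is independent and }\chi(F-I)\le r\}$. $\mathrm{ex}_F(n,\Delta)$ and $\mathrm{spex}_F(n,\Delta)$ are respectively the maximum of $e(G)$ and the maximum of $\rho(G)$ over all $n$-vertex $F$-free graphs $G$ with $\Delta(G)=\Delta$ exactly. $T(m,p)$ is the balanced complete $p$-partite graph on $m$ vertices, $\vee$ denotes the join of vertex-disjoint graphs, $qK_1$ is the edgeless graph on $q$ vertices, and $S_{n,\Delta}^{(r)}:=(n-\Delta)K_1\vee T(\Delta,r-1)$. *)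

theory Defs
  imports
    "Graph_Theory.Pair_Digraph"
    "Jordan_Normal_Form.Spectral_Radius"
    "HOL-Library.Landau_Symbols"
begin

text \<open>
  A finite simple undirected graph is a pair digraph satisfying \<^const>\<open>pair_graph\<close>
  (finite, loopless, symmetric); each undirected edge is then represented by two opposite arcs.
\<close>

definition num_edges :: "'a pair_pre_digraph \<Rightarrow> nat" where
  "num_edges G = card {{u, v} | u v. (u, v) \<in> parcs G}"

definition max_degree :: "'a pair_pre_digraph \<Rightarrow> nat" where
  "max_degree G = Max (out_degree (with_proj G) ` pverts G)"

definition colourable :: "'a pair_pre_digraph \<Rightarrow> nat \<Rightarrow> bool" where
  "colourable G k \<longleftrightarrow>
     (\<exists>c :: 'a \<Rightarrow> nat. (\<forall>v \<in> pverts G. c v < k) \<and> (\<forall>(u, v) \<in> parcs G. c u \<noteq> c v))"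

definition chromatic_number :: "'a pair_pre_digraph \<Rightarrow> nat" where
  "chromatic_number G = (LEAST k. colourable G k)"

definition delete_vertices :: "'a pair_pre_digraph \<Rightarrow> 'a set \<Rightarrow> 'a pair_pre_digraph" where
  "delete_vertices G I =
     \<lparr>pverts = pverts G - I, parcs = {(u, v) \<in> parcs G. u \<notin> I \<and> v \<notin> I}\<rparr>"

definition independent_set :: "'a pair_pre_digraph \<Rightarrow> 'a set \<Rightarrow> bool" where
  "independent_set G I \<longleftrightarrow> I \<subseteq> pverts G \<and> (\<forall>u \<in> I. \<forall>v \<in> I. (u, v) \<notin> parcs G)"

text \<open>
  The invariant $a(F)$; for $\chi(F) = r + 1$ the bound \<^term>\<open>chromatic_number F - 1\<close> is $r$.
\<close>

definition indep_reduction :: "'a pair_pre_digraph \<Rightarrow> nat" where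
  "indep_reduction F =
     Min (card ` {I. independent_set F I \<and>
                     chromatic_number (delete_vertices F I) \<le> chromatic_number F - 1})"

text \<open>Copies are not necessarily induced.\<close>

definition contains_copy :: "'a pair_pre_digraph \<Rightarrow> 'b pair_pre_digraph \<Rightarrow> bool" where
  "contains_copy G F \<longleftrightarrow>
     (\<exists>f. inj_on f (pverts F) \<and> f ` pverts F \<subseteq> pverts G \<and>
          (\<forall>(u, v) \<in> parcs F. (f u, f v) \<in> parcs G))"

text \<open>Rows and columns are indexed by the vertices in increasing order.\<close>

definition adjacency_matrix :: "'a :: linorder pair_pre_digraph \<Rightarrow> complex mat" where
  "adjacency_matrix G =
     (let vs = sorted_list_of_set (pverts G)
      in mat (length vs) (length vs) (\<lambda>(i, j). if (vs ! i, vs ! j) \<in> parcs G then 1 else 0))"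

definition graph_rho :: "'a :: linorder pair_pre_digraph \<Rightarrow> real" where
  "graph_rho G = spectral_radius (adjacency_matrix G)"

text \<open>
  Up to isomorphism the vertex set of an \<open>n\<close>-vertex graph is \<^term>\<open>{..<n}\<close>, so that the maxima
  below range over finite sets.
\<close>

definition free_graphs ::
    "'b pair_pre_digraph \<Rightarrow> nat \<Rightarrow> nat \<Rightarrow> nat pair_pre_digraph set" where
  "free_graphs F n \<Delta> =
     {G. pair_graph G \<and> pverts G = {..<n} \<and> \<not> contains_copy G F \<and> max_degree G = \<Delta>}"

definition ex_deg :: "'b pair_pre_digraph \<Rightarrow> nat \<Rightarrow> nat \<Rightarrow> nat" where
  "ex_deg F n \<Delta> = Max (num_edges ` free_graphs F n \<Delta>)"

definition spex_deg :: "'b pair_pre_digraph \<Rightarrow> nat \<Rightarrow> nat \<Rightarrow> real" where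
  "spex_deg F n \<Delta> = Max (graph_rho ` free_graphs F n \<Delta>)"

text \<open>The parts are the residue classes modulo \<open>p\<close>, whose sizes differ by at most one.\<close>

definition turan_graph :: "nat \<Rightarrow> nat \<Rightarrow> nat pair_pre_digraph" where
  "turan_graph m p =
     \<lparr>pverts = {..<m}, parcs = {(i, j). i < m \<and> j < m \<and> i mod p \<noteq> j mod p}\<rparr>"

definition edgeless_graph :: "'a set \<Rightarrow> 'a pair_pre_digraph" where
  "edgeless_graph V = \<lparr>pverts = V, parcs = {}\<rparr>"

text \<open>Meant for graphs with disjoint vertex sets.\<close>

definition graph_join ::
    "'a pair_pre_digraph \<Rightarrow> 'a pair_pre_digraph \<Rightarrow> 'a pair_pre_digraph" where
  "graph_join G H =
     \<lparr>pverts = pverts G \<union> pverts H,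
      parcs = parcs G \<union> parcs H \<union> pverts G \<times> pverts H \<union> pverts H \<times> pverts G\<rparr>"

text \<open>
  For $\Delta \le n$ this is $(n - \Delta) K_1 \vee T(\Delta, r - 1)$, the edgeless part living on
  the \<open>n - \<Delta>\<close> vertices \<^term>\<open>{\<Delta>..<n}\<close>.
\<close>

definition S_graph :: "nat \<Rightarrow> nat \<Rightarrow> nat \<Rightarrow> nat pair_pre_digraph" where
  "S_graph r n \<Delta> = graph_join (edgeless_graph {\<Delta>..<n}) (turan_graph \<Delta> (r - 1))"

text \<open>
  The filter on pairs \<open>(n, \<Delta>)\<close> for \<open>n \<rightarrow> \<infinity>\<close>, uniformly in the admissible \<open>\<Delta>\<close>: a property holds
  eventually iff there is an \<open>N\<close> such that it holds for all \<open>n \<ge> N\<close> and all admissible \<open>\<Delta>\<close>.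
\<close>

definition uniform_filter :: "nat \<Rightarrow> (nat \<times> nat) filter" where
  "uniform_filter r =
     inf (filtercomap fst sequentially)
         (principal {(n, \<Delta>). \<lceil>(real r - 1) * real n / real r\<rceil> \<le> int \<Delta> \<and> int \<Delta> \<le> int n - 1})"

end

theory Submission
  imports Defs "HOL-Analysis.Convex"
begin

text \<open>
  Put \<open>p = r - 1\<close>. As \<open>a(F) = 1\<close>, some vertex of \<open>F\<close> can be deleted to leave an \<open>r\<close>-colourable
  graph. Hence in an \<open>F\<close>-free graph the neighbourhood \<open>A\<close> of a vertex of maximum degree \<open>\<Delta>\<close>
  contains no complete \<open>r\<close>-partite graph with large parts, and a weighted form of the
  Erdos--Stone theorem (Moon--Moser inequalities for weighted cliques, followed by the
  Kovari--Sos--Turan argument for hypergraphs) bounds every quadratic form of the graph on \<open>A\<close>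
  with bounded weights \<open>y\<close> by \<open>(1 - 1/p) (\<Sum>y)\<^sup>2 + o(n\<^sup>2)\<close>. The \<open>n - \<Delta>\<close> vertices outside \<open>A\<close>
  have degree at most \<open>\<Delta>\<close>. Counting arcs gives the upper bound for the number of edges.

  For the spectral radius, apply this to the modulus of a leading eigenvector, whose entries are
  \<open>O(n\<^sup>-\<^sup>1\<^sup>/\<^sup>2)\<close>. It remains to see that the contribution of each outer vertex is largest when all its
  neighbours lie in \<open>A\<close>; this is where \<open>n - \<Delta> \<le> \<Delta>/p\<close> and \<open>1 - 1/p \<ge> 1/2\<close>, that is
  \<open>r \<ge> 3\<close>, enter. The resulting bound is the positive root of \<open>\<Lambda>\<^sup>2 = (1 - 1/p) \<Delta> \<Lambda> + \<Delta> (n - \<Delta>)\<close>,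
  which the spectral radius of \<open>S\<close> matches up to an additive constant. The graph \<open>S\<close> itself is
  \<open>r\<close>-partite, hence \<open>F\<close>-free, and has maximum degree \<open>\<Delta>\<close>.
\<close>

section \<open>Weighted clique counts\<close>

definition cliques :: "'a set \<Rightarrow> 'a rel \<Rightarrow> nat \<Rightarrow> 'a set set" where
  "cliques V E s = {T. T \<subseteq> V \<and> card T = s \<and> (\<forall>u\<in>T. \<forall>v\<in>T. u \<noteq> v \<longrightarrow> (u, v) \<in> E)}"

definition common_nbrs :: "'a set \<Rightarrow> 'a rel \<Rightarrow> 'a set \<Rightarrow> 'a set" where
  "common_nbrs V E T = {v \<in> V. \<forall>u\<in>T. (u, v) \<in> E}"

text \<open>For weights identically 1 this is the number of \<open>s\<close>-cliques; later the
  weights are rescaled eigenvector entries.\<close>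

definition clique_weight :: "'a set \<Rightarrow> 'a rel \<Rightarrow> ('a \<Rightarrow> real) \<Rightarrow> nat \<Rightarrow> real" where
  "clique_weight V E y s = (\<Sum>T\<in>cliques V E s. prod y T)"

locale weighted_graph =
  fixes V :: "'a set" and E :: "'a rel" and y :: "'a \<Rightarrow> real"
  assumes finV: "finite V" and symE: "sym E" and irreflE: "irrefl E"
    and y_nonneg: "\<And>v. v \<in> V \<Longrightarrow> 0 \<le> y v"
begin

abbreviation "C \<equiv> cliques V E"
abbreviation "k \<equiv> clique_weight V E y"
abbreviation "Nb \<equiv> common_nbrs V E"
abbreviation "dg T \<equiv> sum y (Nb T)"
abbreviation "tot \<equiv> sum y V"

lemma finite_cliques: "finite (C s)"
  by (rule finite_subset[of _ "Pow V"]) (auto simp: cliques_def finV)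

lemma finite_Nb: "finite (Nb T)"
  using finV by (simp add: common_nbrs_def)

lemma clique_finite: "T \<in> C s \<Longrightarrow> finite T"
  using finV finite_subset by (auto simp: cliques_def)

lemma prod_nonneg_clique: "T \<in> C s \<Longrightarrow> 0 \<le> prod y T"
  using y_nonneg by (auto simp: cliques_def intro!: prod_nonneg)

lemma clique_weight_nonneg: "0 \<le> k s"
  unfolding clique_weight_def by (intro sum_nonneg prod_nonneg_clique)

lemma Nb_notin: "v \<in> Nb T \<Longrightarrow> v \<notin> T"
  using irreflE by (auto simp: common_nbrs_def irrefl_def)

text \<open>Pairs of a larger clique and one of its vertices correspond to pairs of an
  \<open>s\<close>-clique and a common neighbour of it. The summand \<open>f\<close> is left free
  because two weightings are needed below, for the first and the second moment of
  \<open>dg\<close>.\<close>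

lemma sum_clique_extension:
  "(\<Sum>T\<in>C (Suc s). \<Sum>v\<in>T. f (T - {v}) v) = (\<Sum>T\<in>C s. \<Sum>v\<in>Nb T. f T v)"
proof -
  have "(\<Sum>T\<in>C (Suc s). \<Sum>v\<in>T. f (T - {v}) v) = (\<Sum>(T,v)\<in>Sigma (C (Suc s)) (\<lambda>T. T). f (T - {v}) v)"
    by (rule sum.Sigma) (auto simp: finite_cliques clique_finite)
  also have "\<dots> = (\<Sum>(T,v)\<in>Sigma (C s) Nb. f T v)"
  proof (rule sum.reindex_bij_witness[where i = "\<lambda>(T,v). (insert v T, v)" and j = "\<lambda>(T,v). (T - {v}, v)"])
    fix a assume "a \<in> Sigma (C (Suc s)) (\<lambda>T. T)"
    then obtain T v where a: "a = (T, v)" "T \<in> C (Suc s)" "v \<in> T" by auto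
    show "(case case a of (T, v) \<Rightarrow> (T - {v}, v) of (T, v) \<Rightarrow> (insert v T, v)) = a"
      using a by auto
    show "(case a of (T, v) \<Rightarrow> (T - {v}, v)) \<in> Sigma (C s) Nb"
      using a clique_finite[OF a(2)] by (auto simp: cliques_def common_nbrs_def)
    show "(case case a of (T, v) \<Rightarrow> (T - {v}, v) of (T, v) \<Rightarrow> f T v) = (case a of (T, v) \<Rightarrow> f (T - {v}) v)"
      using a by auto
  next
    fix a assume "a \<in> Sigma (C s) Nb"
    then obtain T v where a: "a = (T, v)" "T \<in> C s" "v \<in> Nb T" by auto
    show "(case case a of (T, v) \<Rightarrow> (insert v T, v) of (T, v) \<Rightarrow> (T - {v}, v)) = a"
      using a Nb_notin by auto
    show "(case a of (T, v) \<Rightarrow> (insert v T, v)) \<in> Sigma (C (Suc s)) (\<lambda>T. T)"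
      using a clique_finite[OF a(2)] Nb_notin[OF a(3)] symE
      by (auto simp: cliques_def common_nbrs_def dest: symD)
  qed
  also have "\<dots> = (\<Sum>T\<in>C s. \<Sum>v\<in>Nb T. f T v)"
    by (rule sum.Sigma[symmetric]) (auto simp: finite_cliques finite_Nb)
  finally show ?thesis .
qed

lemma prod_remove_clique: "T \<in> C s \<Longrightarrow> v \<in> T \<Longrightarrow> prod y (T - {v}) * y v = prod y T"
  using prod.remove[of T v y] clique_finite by (simp add: mult.commute)

lemma clique_weight_Suc: "real (Suc s) * k (Suc s) = (\<Sum>T\<in>C s. prod y T * dg T)"
proof -
  have "real (Suc s) * k (Suc s) = (\<Sum>T\<in>C (Suc s). \<Sum>v\<in>T. prod y (T - {v}) * y v)"
    unfolding clique_weight_def sum_distrib_left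
    by (rule sum.cong) (auto simp: prod_remove_clique cliques_def)
  also have "\<dots> = (\<Sum>T\<in>C s. \<Sum>v\<in>Nb T. prod y T * y v)"
    by (rule sum_clique_extension)
  finally show ?thesis by (simp add: sum_distrib_left)
qed

text \<open>The double count again, now carrying the factor \<open>dg\<close> of the smaller clique:
  the weights of the common neighbours of \<open>T\<close> add up to a second factor
  \<open>dg T\<close>.\<close>

lemma sum_dg_square:
  "(\<Sum>T\<in>C (Suc s). prod y T * (\<Sum>v\<in>T. dg (T - {v}))) = (\<Sum>T\<in>C s. prod y T * (dg T)\<^sup>2)"
proof -
  have "(\<Sum>T\<in>C (Suc s). prod y T * (\<Sum>v\<in>T. dg (T - {v})))
      = (\<Sum>T\<in>C (Suc s). \<Sum>v\<in>T. prod y (T - {v}) * y v * dg (T - {v}))"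
    unfolding sum_distrib_left
    by (rule sum.cong) (auto simp: prod_remove_clique intro!: sum.cong)
  also have "\<dots> = (\<Sum>T\<in>C s. \<Sum>v\<in>Nb T. prod y T * y v * dg T)"
    by (rule sum_clique_extension)
  also have "\<dots> = (\<Sum>T\<in>C s. prod y T * (dg T)\<^sup>2)"
    by (rule sum.cong) (simp_all add: sum_distrib_left sum_distrib_right power2_eq_square mult_ac)
  finally show ?thesis .
qed

text \<open>A vertex outside the common neighbourhood of \<open>T\<close> has at most one \<open>v \<in> T\<close> for which it is
  adjacent to all of \<open>T - {v}\<close>.\<close>

lemma sum_dg_remove_le:
  assumes T: "T \<in> C (Suc s)"
  shows "(\<Sum>v\<in>T. dg (T - {v})) \<le> tot + real s * dg T"
proof -
  have fin: "finite T" and card: "card T = Suc s"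
    using T clique_finite[OF T] by (auto simp: cliques_def)
  have dg_eq: "dg S = (\<Sum>x\<in>V. if x \<in> Nb S then y x else 0)" for S
  proof -
    have "Nb S = {x \<in> V. x \<in> Nb S}" by (auto simp: common_nbrs_def)
    then show ?thesis using sum.inter_filter[OF finV, of y "\<lambda>x. x \<in> Nb S"] by simp
  qed
  have pt: "(\<Sum>v\<in>T. if x \<in> Nb (T - {v}) then y x else 0)
      \<le> y x + real s * (if x \<in> Nb T then y x else 0)" if x: "x \<in> V" for x
  proof (cases "x \<in> Nb T")
    case True
    have "(\<Sum>v\<in>T. if x \<in> Nb (T - {v}) then y x else 0) \<le> (\<Sum>v\<in>T. y x)"
      by (rule sum_mono) (use y_nonneg[OF x] in auto)
    also have "\<dots> = y x + real s * y x" by (simp add: card algebra_simps)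
    finally show ?thesis using True by simp
  next
    case False
    have "\<exists>w\<in>T. (w, x) \<notin> E" using False x by (auto simp: common_nbrs_def)
    then obtain w where w: "w \<in> T" "(w, x) \<notin> E" by auto
    have out: "x \<notin> Nb (T - {v})" if "v \<noteq> w" for v
      using w that by (auto simp: common_nbrs_def)
    have "(\<Sum>v\<in>T. if x \<in> Nb (T - {v}) then y x else 0) \<le> (\<Sum>v\<in>T. if v = w then y x else 0)"
      by (rule sum_mono) (use y_nonneg[OF x] out w in auto)
    also have "\<dots> = y x" using w fin by simp
    finally show ?thesis using False by simp
  qed
  have "(\<Sum>v\<in>T. dg (T - {v})) = (\<Sum>x\<in>V. \<Sum>v\<in>T. if x \<in> Nb (T - {v}) then y x else 0)"
    unfolding dg_eq by (rule sum.swap)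
  also have "\<dots> \<le> (\<Sum>x\<in>V. y x + real s * (if x \<in> Nb T then y x else 0))"
    by (rule sum_mono) (rule pt)
  also have "\<dots> = tot + real s * dg T"
    unfolding dg_eq by (simp add: sum.distrib sum_distrib_left)
  finally show ?thesis .
qed

text \<open>Weighted Moon--Moser inequality. By Cauchy--Schwarz the squared first moment of
  \<open>dg\<close> is at most \<open>k s\<close> times its second moment;
  \<open>sum_dg_square\<close> moves the latter to larger cliques, where
  \<open>sum_dg_remove_le\<close> bounds it.\<close>

lemma moon_moser:
  "(real (Suc s) * k (Suc s))\<^sup>2
     \<le> k s * (tot * k (Suc s) + real s * (real (Suc (Suc s)) * k (Suc (Suc s))))"
proof -
  have "(\<Sum>T\<in>C s. prod y T * dg T)\<^sup>2
      = (\<Sum>T\<in>C s. sqrt (prod y T) * (sqrt (prod y T) * dg T))\<^sup>2"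
    by (rule arg_cong[where f = "\<lambda>x. x\<^sup>2"], rule sum.cong)
       (auto simp: prod_nonneg_clique mult.assoc[symmetric])
  also have "\<dots> \<le> (\<Sum>T\<in>C s. (sqrt (prod y T))\<^sup>2) * (\<Sum>T\<in>C s. (sqrt (prod y T) * dg T)\<^sup>2)"
    by (rule Cauchy_Schwarz_ineq_sum)
  also have "\<dots> = k s * (\<Sum>T\<in>C s. prod y T * (dg T)\<^sup>2)"
    by (simp add: clique_weight_def power_mult_distrib prod_nonneg_clique)
  finally have cs: "(\<Sum>T\<in>C s. prod y T * dg T)\<^sup>2 \<le> k s * (\<Sum>T\<in>C s. prod y T * (dg T)\<^sup>2)" .
  have "(\<Sum>T\<in>C s. prod y T * (dg T)\<^sup>2)
      \<le> (\<Sum>T\<in>C (Suc s). prod y T * (tot + real s * dg T))"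
    unfolding sum_dg_square[symmetric]
    by (intro sum_mono mult_left_mono sum_dg_remove_le prod_nonneg_clique)
  also have "\<dots> = tot * k (Suc s) + real s * (real (Suc (Suc s)) * k (Suc (Suc s)))"
    unfolding clique_weight_Suc[of "Suc s"]
    by (simp add: clique_weight_def sum_distrib_left sum.distrib algebra_simps)
  finally show ?thesis
    unfolding clique_weight_Suc[of s]
    by (intro order_trans[OF cs] mult_left_mono clique_weight_nonneg)
qed

lemma cliques_0: "C 0 = {{}}"
proof -
  have "T = {}" if "T \<in> C 0" for T
    using clique_finite[OF that] that by (simp add: cliques_def)
  moreover have "{} \<in> C 0" by (simp add: cliques_def)
  ultimately show ?thesis by blast
qed

lemma clique_weight_0: "k 0 = 1"
  by (simp add: clique_weight_def cliques_0)

lemma clique_weight_1: "k (Suc 0) = tot"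
  using clique_weight_Suc[of 0] by (simp add: cliques_0 common_nbrs_def)

lemma clique_weight_2: "2 * k 2 = (\<Sum>u\<in>V. \<Sum>v\<in>V. if (u, v) \<in> E then y u * y v else 0)"
proof -
  have "2 * k 2 = (\<Sum>T\<in>C 1. prod y T * dg T)"
    using clique_weight_Suc[of 1] by (simp add: numeral_2_eq_2)
  also have "\<dots> = (\<Sum>u\<in>V. y u * dg {u})"
    by (rule sum.reindex_bij_witness[where i = "\<lambda>u. {u}" and j = the_elem])
       (auto simp: cliques_def card_1_singleton_iff)
  also have "\<dots> = (\<Sum>u\<in>V. \<Sum>v\<in>V. if (u, v) \<in> E then y u * y v else 0)"
    using finV by (intro sum.cong refl)
      (simp add: sum_distrib_left common_nbrs_def sum.If_cases Int_def conj_commute)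
  finally show ?thesis .
qed

text \<open>An edge density beyond the Turan threshold propagates upwards: Moon--Moser keeps each
  ratio of consecutive normalised clique weights at least \<open>\<epsilon> * tot\<close>, up to
  cliques of size \<open>p + 1\<close>.\<close>

lemma many_cliques:
  assumes p: "p \<ge> 1" and eps: "0 < \<epsilon>" "\<epsilon> \<le> 1"
    and tot: "0 < tot" and dens: "(1 - 1 / real p + \<epsilon>) * tot\<^sup>2 \<le> 2 * k 2"
  shows "(\<epsilon> * tot) ^ Suc p \<le> fact (Suc p) * k (Suc p)"
proof -
  \<comment> \<open>Ordered cliques: the factorials absorb most numerical factors of
    \<open>moon_moser\<close>.\<close>
  define W where "W s = fact s * k s" for s
  \<comment> \<open>Chosen so that \<open>dens\<close> reads
    \<open>(1 - g) * tot\<^sup>2 \<le> W 2\<close> while \<open>1 - s * g\<close> stays at least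
    \<open>\<epsilon>\<close> for all \<open>s \<le> p\<close>.\<close>
  define g where "g = 1 / real p - \<epsilon>"
  have W0: "W 0 = 1" by (simp add: W_def clique_weight_0)
  have W1: "W 1 = tot" by (simp add: W_def clique_weight_1)
  have W2: "(1 - g) * tot\<^sup>2 \<le> W 2" using dens by (simp add: W_def g_def diff_diff_eq2 diff_add_eq)
  have q: "\<epsilon> \<le> 1 - real s * g" if "s \<le> p" for s
  proof (cases "s = 0")
    case False
    have 1: "real s / real p \<le> 1"
      using that p by (simp add: divide_le_eq)
    have 2: "\<epsilon> * 1 \<le> \<epsilon> * real s"
      using False eps by (intro mult_left_mono) auto
    have "1 - real s * g = 1 - real s / real p + \<epsilon> * real s"
      by (simp add: g_def right_diff_distrib mult.commute)
    then show ?thesis using 1 2 by linarith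
  qed (use eps in simp)
  have MM: "real (Suc s) * (W (Suc s))\<^sup>2 \<le> W s * (tot * W (Suc s) + real s * W (Suc (Suc s)))" for s
  proof -
    have eq2: "a * (R * a) * (x * (n * y' + r * (R' * z))) = a * x * (n * (R * a * y') + r * (R' * (R * a) * z))"
      for R R' a x n y' z r :: real
      by (simp add: algebra_simps)
    have eq: "R * (R * a * x)\<^sup>2 = a * (R * a) * (R * x)\<^sup>2" for R a x :: real
      by (simp add: power2_eq_square)
    have "real (Suc s) * (W (Suc s))\<^sup>2 = (fact s * fact (Suc s)) * (real (Suc s) * k (Suc s))\<^sup>2"
      unfolding W_def fact_Suc by (rule eq)
    also have "\<dots> \<le> (fact s * fact (Suc s)) * (k s * (tot * k (Suc s)
        + real s * (real (Suc (Suc s)) * k (Suc (Suc s)))))"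
      by (intro mult_left_mono moon_moser) simp
    also have "\<dots> = W s * (tot * W (Suc s) + real s * W (Suc (Suc s)))"
      unfolding W_def fact_Suc by (rule eq2)
    finally show ?thesis .
  qed
  \<comment> \<open>The ratio bound is the real claim; the power bound supplies the positivity of
    \<open>W s\<close>, by which the induction step divides.\<close>
  have main: "s \<le> p \<Longrightarrow> (1 - real s * g) * tot * W s \<le> W (Suc s) \<and> (\<epsilon> * tot) ^ s \<le> W s" for s
  proof (induction s)
    case 0
    then show ?case using W0 W1 by simp
  next
    case (Suc s)
    then have IH: "(1 - real s * g) * tot * W s \<le> W (Suc s)" "(\<epsilon> * tot) ^ s \<le> W s"
      and sp: "s \<le> p" by auto
    have Ws: "0 < W s" using IH(2) eps tot by (meson less_le_trans mult_pos_pos zero_less_power)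
    have "(\<epsilon> * tot) ^ Suc s \<le> (\<epsilon> * tot) * W s"
      using IH(2) eps tot by simp
    also have "\<dots> \<le> (1 - real s * g) * tot * W s"
      using q[OF sp] tot Ws by (intro mult_right_mono) auto
    finally have pow: "(\<epsilon> * tot) ^ Suc s \<le> W (Suc s)" using IH(1) by linarith
    have WS: "0 < W (Suc s)" using pow eps tot by (meson less_le_trans mult_pos_pos zero_less_power)
    show ?case
    proof (cases "s = 0")
      \<comment> \<open>For \<open>s = 0\<close> Moon--Moser says nothing about \<open>W 2\<close>;
        this first ratio is the density hypothesis itself.\<close>
      case True
      then show ?thesis using W2 W1 pow by (simp add: power2_eq_square numeral_2_eq_2)
    next
      case False
      \<comment> \<open>Inserting the previous ratio into Moon--Moser and cancelling
        \<open>W s\<close> leaves the factor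
        \<open>(s + 1) * (1 - s * g) - 1 = s * (1 - (s + 1) * g)\<close>.\<close>
      have "real (Suc s) * ((1 - real s * g) * tot * W s) * W (Suc s) \<le> real (Suc s) * W (Suc s) * W (Suc s)"
        using IH(1) WS by (intro mult_right_mono mult_left_mono) auto
      also have "\<dots> \<le> W s * (tot * W (Suc s) + real s * W (Suc (Suc s)))"
        using MM[of s] by (simp add: power2_eq_square mult_ac)
      finally have "W s * (real (Suc s) * ((1 - real s * g) * tot) * W (Suc s))
          \<le> W s * (tot * W (Suc s) + real s * W (Suc (Suc s)))"
        by (simp only: mult_ac)
      then have "real (Suc s) * ((1 - real s * g) * tot) * W (Suc s)
          \<le> tot * W (Suc s) + real s * W (Suc (Suc s))"
        using Ws by (simp only: mult_le_cancel_left_pos)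
      then have "real s * ((1 - real (Suc s) * g) * tot * W (Suc s)) \<le> real s * W (Suc (Suc s))"
        by (simp add: algebra_simps)
      then show ?thesis using False pow by simp
    qed
  qed
  have "(\<epsilon> * tot) ^ Suc p \<le> (\<epsilon> * tot) * W p"
    using main[of p] eps tot by simp
  also have "\<dots> \<le> (1 - real p * g) * tot * W p"
  proof -
    have "0 \<le> W p" by (simp add: W_def clique_weight_nonneg)
    then show ?thesis using q[of p] tot by (intro mult_right_mono) auto
  qed
  also have "\<dots> \<le> W (Suc p)" using main[of p] by simp
  finally show ?thesis by (simp add: W_def)
qed

end

section \<open>A weighted Erdos--Stone theorem\<close>

lemma in_listset_iff:
  "xs \<in> listset Ts \<longleftrightarrow> length xs = length Ts \<and> (\<forall>i<length Ts. xs ! i \<in> Ts ! i)"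
proof (induction Ts arbitrary: xs)
  case (Cons T Ts)
  show ?case
    by (cases xs) (auto simp: set_Cons_def Cons.IH nth_Cons split: nat.splits)
qed auto

text \<open>Hyperedges are lists, and \<open>listset Ts\<close> is a complete
  \<open>r\<close>-partite hypergraph. Induction on \<open>r\<close>: given a bounded number
  \<open>M\<close> of vertices with dense links, a positive fraction of the tuples lies in at least
  \<open>t\<close> of these links; by the pigeonhole principle some \<open>t\<close>-subset has a
  dense common link, to which the induction hypothesis applies.\<close>

lemma hypergraph_kovari_sos_turan:
  fixes \<delta> :: real
  assumes "0 < \<delta>"
  shows "\<exists>N. \<forall>(V :: 'a set) H. finite V \<longrightarrow> N \<le> card V \<longrightarrow>
    H \<subseteq> {xs. set xs \<subseteq> V \<and> length xs = r} \<longrightarrow> \<delta> * real (card V) ^ r \<le> real (card H) \<longrightarrow>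
    (\<exists>Ts. length Ts = r \<and> (\<forall>T\<in>set Ts. T \<subseteq> V \<and> card T = t) \<and> listset Ts \<subseteq> H)"
  using assms
proof (induction r arbitrary: \<delta>)
  case 0
  show ?case
  proof (intro exI[of _ 0] allI impI)
    fix V :: "'a set" and H
    assume "H \<subseteq> {xs. set xs \<subseteq> V \<and> length xs = 0}" "\<delta> * real (card V) ^ 0 \<le> real (card H)"
    then have "H \<noteq> {}" "H \<subseteq> {[]}" using 0 by auto
    then have "[] \<in> H" by blast
    then show "\<exists>Ts. length Ts = 0 \<and> (\<forall>T\<in>set Ts. T \<subseteq> V \<and> card T = t) \<and> listset Ts \<subseteq> H"
      by auto
  qed
next
  case (Suc r)
  note \<delta> = \<open>0 < \<delta>\<close>
  \<comment> \<open>Tuples lying in fewer than \<open>t\<close> links use up at most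
    \<open>t / M \<le> \<delta> / 4\<close> of the link density \<open>\<delta> / 2\<close>. The
    added 1 keeps \<open>M\<close> positive when \<open>t = 0\<close>.\<close>
  define M where "M = nat \<lceil>4 * real t / \<delta>\<rceil> + 1"
  have M: "4 * real t \<le> \<delta> * real M" "0 < M"
  proof -
    have "4 * real t / \<delta> \<le> real M" unfolding M_def by linarith
    then show "4 * real t \<le> \<delta> * real M" using \<delta> by (simp add: pos_divide_le_eq mult.commute)
  qed (simp add: M_def)
  \<comment> \<open>\<open>\<delta> / 4\<close> is the density of the good tuples, and
    \<open>2 ^ M\<close> bounds the number of \<open>t\<close>-subsets over which they are
    distributed.\<close>
  define \<delta>' where "\<delta>' = \<delta> / 4 / 2 ^ M"
  have "0 < \<delta>'" using \<delta> by (simp add: \<delta>'_def)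
  from Suc.IH[OF this] obtain N' where N': "\<And>(V :: 'a set) H. finite V \<Longrightarrow> N' \<le> card V \<Longrightarrow>
    H \<subseteq> {xs. set xs \<subseteq> V \<and> length xs = r} \<Longrightarrow> \<delta>' * real (card V) ^ r \<le> real (card H) \<Longrightarrow>
    \<exists>Ts. length Ts = r \<and> (\<forall>T\<in>set Ts. T \<subseteq> V \<and> card T = t) \<and> listset Ts \<subseteq> H"
    by blast
  define N where "N = max N' (nat \<lceil>2 * real M / \<delta>\<rceil> + 1)"
  show ?case
  proof (intro exI[of _ N] allI impI)
    fix V :: "'a set" and H
    assume fin: "finite V" and N: "N \<le> card V"
      and H: "H \<subseteq> {xs. set xs \<subseteq> V \<and> length xs = Suc r}"
      and cardH: "\<delta> * real (card V) ^ Suc r \<le> real (card H)"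
    define m where "m = card V"
    have m: "2 * real M \<le> \<delta> * real m" "0 < m"
    proof -
      have "2 * real M / \<delta> \<le> real m" using N unfolding N_def m_def by linarith
      then show "2 * real M \<le> \<delta> * real m" using \<delta> by (simp add: pos_divide_le_eq mult.commute)
      show "0 < m" using N unfolding N_def m_def by linarith
    qed
    define X where "X = {xs. set xs \<subseteq> V \<and> length xs = r}"
    have X: "finite X" "card X = m ^ r"
      using fin by (simp_all add: X_def m_def finite_lists_length_eq card_lists_length_eq)
    define L where "L v = {xs\<in>X. v # xs \<in> H}" for v
    have L: "finite (L v)" "card (L v) \<le> m ^ r" for v
      using X card_mono[of X "L v"] by (auto simp: L_def)
    have "bij_betw (\<lambda>(v, xs). v # xs) (Sigma V L) H"
      unfolding bij_betw_def
    proof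
      show "(\<lambda>(v, xs). v # xs) ` Sigma V L = H"
      proof
        show "H \<subseteq> (\<lambda>(v, xs). v # xs) ` Sigma V L"
        proof
          fix zs assume zs: "zs \<in> H"
          then obtain v xs where "zs = v # xs" using H by (cases zs) auto
          moreover from this have "v \<in> V" "xs \<in> L v" using zs subsetD[OF H zs] by (auto simp: L_def X_def)
          ultimately show "zs \<in> (\<lambda>(v, xs). v # xs) ` Sigma V L" by force
        qed
      qed (auto simp: L_def)
    qed (auto simp: inj_on_def)
    then have "card H = card (Sigma V L)" by (simp add: bij_betw_same_card)
    also have "\<dots> = (\<Sum>v\<in>V. card (L v))" using fin L by (intro card_SigmaI) auto
    finally have sumL: "card H = (\<Sum>v\<in>V. card (L v))" .
    \<comment> \<open>Averaging: vertices outside \<open>V'\<close> account for at most half of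
      \<open>H\<close>, so at least \<open>\<delta> * m / 2 \<ge> M\<close> vertices have a dense
      link.\<close>
    define V' where "V' = {v\<in>V. \<delta> / 2 * real m ^ r \<le> real (card (L v))}"
    have "real (card H) \<le> (\<Sum>v\<in>V. (if v \<in> V' then real m ^ r else 0) + \<delta> / 2 * real m ^ r)"
      unfolding sumL of_nat_sum
    proof (rule sum_mono)
      fix v assume "v \<in> V"
      have a: "real (card (L v)) \<le> real m ^ r" using L(2)[of v] by (metis of_nat_le_iff of_nat_power)
      have b: "0 \<le> \<delta> / 2 * real m ^ r" using \<delta> by simp
      show "real (card (L v)) \<le> (if v \<in> V' then real m ^ r else 0) + \<delta> / 2 * real m ^ r"
      proof (cases "v \<in> V'")
        case True
        show ?thesis unfolding if_P[OF True] using a b by linarith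
      next
        case False
        then have "real (card (L v)) < \<delta> / 2 * real m ^ r"
          using \<open>v \<in> V\<close> unfolding V'_def mem_Collect_eq by linarith
        then show ?thesis unfolding if_not_P[OF False] by linarith
      qed
    qed
    also have "\<dots> = real (card V') * real m ^ r + real m * (\<delta> / 2 * real m ^ r)"
    proof -
      have "V \<inter> {v. v \<in> V'} = V'" by (auto simp: V'_def)
      then show ?thesis using fin by (simp add: sum.distrib sum.If_cases m_def)
    qed
    finally have "\<delta> * real m * real m ^ r
        \<le> real (card V') * real m ^ r + real m * (\<delta> / 2 * real m ^ r)"
      using cardH by (simp add: m_def mult.assoc)
    then have "(\<delta> * real m) * real m ^ r \<le> (real (card V') + real m * (\<delta> / 2)) * real m ^ r"
      by (simp add: algebra_simps)
    then have "\<delta> * real m \<le> real (card V') + real m * (\<delta> / 2)"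
      using m by (subst (asm) mult_le_cancel_right_pos) auto
    then have "M \<le> card V'" using m by (simp add: field_simps)
    then obtain U where U: "U \<subseteq> V'" "card U = M" "finite U"
      by (rule obtain_subset_with_card_n)
    define d where "d xs = card {v\<in>U. v # xs \<in> H}" for xs
    define Good where "Good = {xs\<in>X. t \<le> d xs}"
    have dM: "d xs \<le> M" for xs
      unfolding d_def U(2)[symmetric] by (rule card_mono) (use U in auto)
    have cardX: "real (card X) = real m ^ r" by (simp add: X)
    \<comment> \<open>Double count of pairs of a vertex in \<open>U\<close> and a tuple in its link;
      \<open>d xs\<close> is at most \<open>M\<close> on good tuples and below \<open>t\<close>
      elsewhere.\<close>
    have "real M * (\<delta> / 2 * real m ^ r) \<le> (\<Sum>v\<in>U. real (card (L v)))"
    proof -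
      have "(\<Sum>v\<in>U. \<delta> / 2 * real m ^ r) \<le> (\<Sum>v\<in>U. real (card (L v)))"
        by (rule sum_mono) (use U(1) in \<open>auto simp: V'_def\<close>)
      then show ?thesis by (simp add: U)
    qed
    also have "\<dots> = (\<Sum>v\<in>U. \<Sum>xs\<in>X. if v # xs \<in> H then 1 else 0)"
      using X by (intro sum.cong) (simp_all add: L_def sum.If_cases Int_def)
    also have "\<dots> = (\<Sum>xs\<in>X. \<Sum>v\<in>U. if v # xs \<in> H then 1 else 0)" by (rule sum.swap)
    also have "\<dots> = (\<Sum>xs\<in>X. real (d xs))"
      using U by (intro sum.cong) (simp_all add: d_def sum.If_cases Int_def)
    also have "\<dots> \<le> (\<Sum>xs\<in>X. (if xs \<in> Good then real M else 0) + real t)"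
      by (rule sum_mono) (use dM in \<open>auto simp: Good_def intro: add_increasing2\<close>)
    also have "\<dots> = real (card Good) * real M + real m ^ r * real t"
    proof -
      have "X \<inter> {xs. xs \<in> Good} = Good" by (auto simp: Good_def)
      then show ?thesis using X(1) by (simp add: sum.distrib sum.If_cases cardX)
    qed
    finally have "real M * (\<delta> / 2 * real m ^ r) \<le> real (card Good) * real M + real m ^ r * real t" .
    moreover have "real m ^ r * (4 * real t) \<le> real m ^ r * (\<delta> * real M)"
      using M by (intro mult_left_mono) auto
    ultimately have "real M * (\<delta> / 4 * real m ^ r) \<le> real M * real (card Good)"
      by (simp add: algebra_simps)
    then have good: "\<delta> / 4 * real m ^ r \<le> real (card Good)"
      using M by (subst (asm) mult_le_cancel_left_pos) auto
    define F where "F = {T. T \<subseteq> U \<and> card T = t}"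
    have F: "finite F" "card F \<le> 2 ^ M"
    proof -
      have "F \<subseteq> Pow U" by (auto simp: F_def)
      then show "finite F" "card F \<le> 2 ^ M"
        using U card_mono[of "Pow U" F] by (auto simp: card_Pow intro: finite_subset)
    qed
    define K where "K T = {xs\<in>X. \<forall>v\<in>T. v # xs \<in> H}" for T
    have "Good \<subseteq> (\<Union>T\<in>F. K T)"
    proof
      fix xs assume "xs \<in> Good"
      then have xs: "xs \<in> X" "t \<le> card {v\<in>U. v # xs \<in> H}" by (auto simp: Good_def d_def)
      obtain T where "T \<subseteq> {v\<in>U. v # xs \<in> H}" "card T = t"
        using obtain_subset_with_card_n[OF xs(2)] by metis
      then show "xs \<in> (\<Union>T\<in>F. K T)" using xs by (auto simp: F_def K_def)
    qed
    then have "card Good \<le> card (\<Union>T\<in>F. K T)"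
      by (rule card_mono[rotated]) (use X F in \<open>auto simp: K_def\<close>)
    also have "\<dots> \<le> (\<Sum>T\<in>F. card (K T))" by (rule card_UN_le) (rule F)
    finally have GK: "card Good \<le> (\<Sum>T\<in>F. card (K T))" .
    \<comment> \<open>Otherwise the common links of all \<open>t\<close>-subsets of \<open>U\<close>
      would be too small to cover \<open>Good\<close>.\<close>
    have "\<exists>T\<in>F. \<delta>' * real m ^ r \<le> real (card (K T))"
    proof (rule ccontr)
      assume "\<not> ?thesis"
      then have lt: "real (card (K T)) < \<delta>' * real m ^ r" if "T \<in> F" for T using that by auto
      have "F \<noteq> {}"
      proof
        assume "F = {}"
        then have "card Good = 0" using GK by simp
        moreover have "0 < \<delta> / 4 * real m ^ r" using \<delta> m by simp
        ultimately show False using good by linarith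
      qed
      have "real (card Good) \<le> (\<Sum>T\<in>F. real (card (K T)))" using GK by (metis of_nat_le_iff of_nat_sum)
      also have "\<dots> < (\<Sum>T\<in>F. \<delta>' * real m ^ r)"
        by (rule sum_strict_mono) (use F \<open>F \<noteq> {}\<close> lt in auto)
      also have "\<dots> = real (card F) * (\<delta>' * real m ^ r)" by simp
      also have "\<dots> \<le> 2 ^ M * (\<delta>' * real m ^ r)"
      proof (rule mult_right_mono)
        show "real (card F) \<le> 2 ^ M" using F(2) by (metis of_nat_le_iff of_nat_numeral of_nat_power)
      qed (use \<open>0 < \<delta>'\<close> in simp)
      also have "\<dots> = \<delta> / 4 * real m ^ r" by (simp add: \<delta>'_def)
      finally show False using good by simp
    qed
    then obtain T where T: "T \<in> F" "\<delta>' * real (card V) ^ r \<le> real (card (K T))"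
      by (auto simp: m_def)
    have "N' \<le> card V" using N by (simp add: N_def)
    moreover have "K T \<subseteq> {xs. set xs \<subseteq> V \<and> length xs = r}" by (auto simp: K_def X_def)
    ultimately obtain Ts where Ts: "length Ts = r" "\<forall>T\<in>set Ts. T \<subseteq> V \<and> card T = t"
      "listset Ts \<subseteq> K T"
      using N'[OF fin _ _ T(2)] by blast
    have "T \<subseteq> V" "card T = t" using T(1) U(1) by (auto simp: F_def V'_def)
    moreover have "listset (T # Ts) \<subseteq> H"
      using Ts(3) by (auto simp: set_Cons_def K_def)
    ultimately show "\<exists>Ts. length Ts = Suc r \<and> (\<forall>T\<in>set Ts. T \<subseteq> V \<and> card T = t) \<and> listset Ts \<subseteq> H"
      using Ts by (intro exI[of _ "T # Ts"]) auto
  qed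
qed

text \<open>For irreflexive \<open>E\<close> the parts are automatically disjoint, as the products
  \<open>T i \<times> T j\<close> lie in \<open>E\<close>.\<close>

definition contains_multipartite :: "'a set \<Rightarrow> 'a rel \<Rightarrow> nat \<Rightarrow> nat \<Rightarrow> bool" where
  "contains_multipartite V E q t \<longleftrightarrow>
     (\<exists>T :: nat \<Rightarrow> 'a set. (\<forall>i<q. T i \<subseteq> V \<and> card (T i) = t) \<and>
       (\<forall>i<q. \<forall>j<q. i \<noteq> j \<longrightarrow> T i \<times> T j \<subseteq> E))"

text \<open>Apply the hypergraph result to the orderings of the \<open>q\<close>-cliques: in a
  complete \<open>q\<close>-partite piece every transversal is a clique, so vertices from different
  parts are adjacent.\<close>

lemma many_cliques_imp_multipartite:
  fixes \<delta> :: real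
  assumes \<delta>: "0 < \<delta>" and t: "1 \<le> t"
  shows "\<exists>N. \<forall>(V :: 'a set) E. finite V \<longrightarrow> N \<le> card V \<longrightarrow>
    \<delta> * real (card V) ^ q \<le> real (card (cliques V E q)) \<longrightarrow> contains_multipartite V E q t"
proof -
  from hypergraph_kovari_sos_turan[OF \<delta>, of q t]
  obtain N where N: "\<And>(V :: 'a set) H. finite V \<Longrightarrow> N \<le> card V \<Longrightarrow>
    H \<subseteq> {xs. set xs \<subseteq> V \<and> length xs = q} \<Longrightarrow> \<delta> * real (card V) ^ q \<le> real (card H) \<Longrightarrow>
    \<exists>Ts. length Ts = q \<and> (\<forall>T\<in>set Ts. T \<subseteq> V \<and> card T = t) \<and> listset Ts \<subseteq> H"
    by blast
  show ?thesis
  proof (intro exI[of _ N] allI impI)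
    fix V :: "'a set" and E
    assume fin: "finite V" and cV: "N \<le> card V"
      and many: "\<delta> * real (card V) ^ q \<le> real (card (cliques V E q))"
    \<comment> \<open>A list of length \<open>q\<close> with \<open>q\<close> elements is distinct,
      so \<open>H\<close> consists exactly of the orderings of the cliques.\<close>
    define H where "H = {xs. length xs = q \<and> set xs \<in> cliques V E q}"
    have Hsub: "H \<subseteq> {xs. set xs \<subseteq> V \<and> length xs = q}" by (auto simp: H_def cliques_def)
    then have "finite H" using finite_lists_length_eq[OF fin] finite_subset by blast
    moreover have "cliques V E q \<subseteq> set ` H"
    proof
      fix T assume T: "T \<in> cliques V E q"
      then have "finite T" using fin finite_subset by (auto simp: cliques_def)
      then obtain xs where "set xs = T" "distinct xs" using finite_distinct_list by blast
      then show "T \<in> set ` H" using T by (auto simp: H_def cliques_def distinct_card image_iff)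
    qed
    ultimately have "card (cliques V E q) \<le> card H"
      by (meson card_image_le card_mono finite_imageI order_trans)
    then have "\<delta> * real (card V) ^ q \<le> real (card H)" using many by linarith
    from N[OF fin cV Hsub this] obtain Ts where Ts: "length Ts = q"
      "\<And>T. T \<in> set Ts \<Longrightarrow> T \<subseteq> V \<and> card T = t" "listset Ts \<subseteq> H" by blast
    have ne: "Ts ! i \<noteq> {}" if "i < q" for i
      using Ts(1) Ts(2)[of "Ts ! i"] that t by auto
    have "(u, w) \<in> E" if ij: "i < q" "j < q" "i \<noteq> j" and u: "u \<in> Ts ! i" and w: "w \<in> Ts ! j" for i j u w
    proof -
      \<comment> \<open>A transversal through \<open>u\<close> and \<open>w\<close>; the other
        entries are arbitrary elements of their parts, which are nonempty because
        \<open>1 \<le> t\<close>.\<close>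
      define xs where "xs = map (\<lambda>l. if l = i then u else if l = j then w else (SOME x. x \<in> Ts ! l)) [0..<q]"
      have "xs ! l \<in> Ts ! l" if "l < q" for l
        using that u w some_in_eq[of "Ts ! l"] ne[OF that] by (auto simp: xs_def)
      then have "xs \<in> listset Ts" by (simp add: in_listset_iff Ts(1)) (simp add: xs_def)
      then have "xs \<in> H" using Ts(3) by blast
      then have len: "length xs = q" and clq: "set xs \<in> cliques V E q" by (auto simp: H_def)
      then have "distinct xs" by (intro card_distinct) (simp add: cliques_def)
      then have "xs ! i \<noteq> xs ! j" using ij len by (simp add: nth_eq_iff_index_eq)
      moreover have "xs ! i = u" "xs ! j = w" using ij by (simp_all add: xs_def)
      moreover have "xs ! i \<in> set xs" "xs ! j \<in> set xs" using ij len by simp_all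
      ultimately show ?thesis using clq by (auto simp: cliques_def)
    qed
    then show "contains_multipartite V E q t"
      unfolding contains_multipartite_def
      using Ts(1,2) by (intro exI[of _ "\<lambda>i. Ts ! i"]) auto
  qed
qed

text \<open>By contradiction. A form exceeding the bound gives an edge density above the Turan
  threshold and, since the form is at most \<open>tot\<^sup>2\<close>, also a total weight of order
  \<open>card V\<close>. Then \<open>many_cliques\<close> yields a clique weight of order
  \<open>card V ^ (p + 1)\<close>, and as the weights are at most 1 there are that many
  cliques.\<close>

theorem weighted_erdos_stone:
  fixes \<epsilon> :: real
  assumes p: "1 \<le> p" and t: "1 \<le> t" and \<epsilon>: "0 < \<epsilon>"
  shows "\<exists>N. \<forall>(V :: 'a set) E y. finite V \<longrightarrow> N \<le> card V \<longrightarrow> sym E \<longrightarrow> irrefl E \<longrightarrow>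
    \<not> contains_multipartite V E (Suc p) t \<longrightarrow> (\<forall>v\<in>V. 0 \<le> y v \<and> y v \<le> 1) \<longrightarrow>
    (\<Sum>u\<in>V. \<Sum>v\<in>V. if (u, v) \<in> E then y u * y v else 0)
      \<le> (1 - 1 / real p) * (sum y V)\<^sup>2 + \<epsilon> * real (card V) ^ 2"
proof -
  \<comment> \<open>\<open>many_cliques\<close> wants an excess of at most 1; the cap also gives
    \<open>\<eta>\<^sup>2 \<le> \<epsilon>\<close>.\<close>
  define \<eta> where "\<eta> = min \<epsilon> 1"
  have \<eta>: "0 < \<eta>" "\<eta> \<le> 1" "\<eta> \<le> \<epsilon>" using \<epsilon> by (auto simp: \<eta>_def)
  \<comment> \<open>In each square one factor \<open>\<eta>\<close> is the density excess, the other
    comes from \<open>\<eta> * m \<le> tot\<close>.\<close>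
  define \<delta> where "\<delta> = (\<eta>\<^sup>2) ^ Suc p / fact (Suc p)"
  have "0 < \<delta>" using \<eta> by (simp add: \<delta>_def)
  from many_cliques_imp_multipartite[OF this t, of "Suc p"]
  obtain N where N: "\<And>(V :: 'a set) E. finite V \<Longrightarrow> N \<le> card V \<Longrightarrow>
    \<delta> * real (card V) ^ Suc p \<le> real (card (cliques V E (Suc p))) \<Longrightarrow> contains_multipartite V E (Suc p) t"
    by blast
  show ?thesis
  proof (intro exI[of _ "max N 1"] allI impI, rule ccontr)
    fix V :: "'a set" and E and y :: "'a \<Rightarrow> real"
    assume fin: "finite V" and cV: "max N 1 \<le> card V" and E: "sym E" "irrefl E"
      and no: "\<not> contains_multipartite V E (Suc p) t" and y: "\<forall>v\<in>V. 0 \<le> y v \<and> y v \<le> 1"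
      and gt: "\<not> (\<Sum>u\<in>V. \<Sum>v\<in>V. if (u, v) \<in> E then y u * y v else 0)
        \<le> (1 - 1 / real p) * (sum y V)\<^sup>2 + \<epsilon> * real (card V) ^ 2"
    interpret weighted_graph V E y using fin E y by unfold_locales auto
    define m where "m = real (card V)"
    have m: "1 \<le> m" using cV by (simp add: m_def)
    have tot: "0 \<le> tot" "tot \<le> m"
    proof -
      show "0 \<le> tot" using y by (intro sum_nonneg) blast
      have "tot \<le> (\<Sum>v\<in>V. 1)" using y by (intro sum_mono) blast
      then show "tot \<le> m" by (simp add: m_def)
    qed
    then have tot2: "tot\<^sup>2 \<le> m\<^sup>2" by (simp add: power_mono)
    have gt': "(1 - 1 / real p) * tot\<^sup>2 + \<epsilon> * m\<^sup>2 < 2 * k 2"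
      using gt by (simp add: clique_weight_2 m_def)
    have "\<eta> * tot\<^sup>2 \<le> \<epsilon> * m\<^sup>2" using \<eta> \<epsilon> tot2 by (intro mult_mono) auto
    then have dens: "(1 - 1 / real p + \<eta>) * tot\<^sup>2 \<le> 2 * k 2"
      using gt' by (simp add: algebra_simps)
    have "2 * k 2 \<le> (\<Sum>u\<in>V. \<Sum>v\<in>V. y u * y v)"
      unfolding clique_weight_2 using y by (intro sum_mono) auto
    also have "\<dots> = tot\<^sup>2" by (simp add: power2_eq_square sum_product)
    finally have k2: "2 * k 2 \<le> tot\<^sup>2" .
    have "(\<eta> * m)\<^sup>2 \<le> \<epsilon> * m\<^sup>2"
    proof -
      have "\<eta> * \<eta> \<le> 1 * \<epsilon>" using \<eta> by (intro mult_mono) auto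
      then show ?thesis by (simp add: power_mult_distrib power2_eq_square[of \<eta>] mult_right_mono)
    qed
    moreover have "0 \<le> (1 - 1 / real p) * tot\<^sup>2" using p by simp
    ultimately have "(\<eta> * m)\<^sup>2 \<le> tot\<^sup>2" using gt' k2 by linarith
    then have le: "\<eta> * m \<le> tot" using tot by (intro power2_le_imp_le[of "\<eta> * m" tot])
    moreover have "0 < \<eta> * m" using \<eta> m by simp
    ultimately have "0 < tot" by linarith
    have "(\<eta>\<^sup>2 * m) ^ Suc p \<le> (\<eta> * tot) ^ Suc p"
    proof (rule power_mono)
      show "\<eta>\<^sup>2 * m \<le> \<eta> * tot" using le \<eta> by (simp add: power2_eq_square mult.assoc)
    qed (use \<eta> m in simp)
    also have "\<dots> \<le> fact (Suc p) * k (Suc p)"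
      by (rule many_cliques[OF p \<eta>(1,2) \<open>0 < tot\<close> dens])
    also have "fact (Suc p) * k (Suc p) \<le> fact (Suc p) * real (card (C (Suc p)))"
    proof (rule mult_left_mono)
      have "k (Suc p) \<le> (\<Sum>T\<in>C (Suc p). 1)"
        unfolding clique_weight_def
        by (intro sum_mono prod_le_1) (use y in \<open>auto simp: cliques_def\<close>)
      then show "k (Suc p) \<le> real (card (C (Suc p)))" by simp
    qed simp
    finally have "(\<eta>\<^sup>2 * m) ^ Suc p \<le> fact (Suc p) * real (card (C (Suc p)))" .
    then have "\<delta> * m ^ Suc p \<le> real (card (C (Suc p)))"
      unfolding \<delta>_def power_mult_distrib[of _ m]
      by (simp add: pos_divide_le_eq mult.commute[of "fact _"] del: fact_Suc power_Suc)
    then have "contains_multipartite V E (Suc p) t"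
      using N[OF fin] cV unfolding m_def by simp
    then show False using no by contradiction
  qed
qed

section \<open>Embeddings and the graph S\<close>

lemma colourable_mono: "colourable G k \<Longrightarrow> k \<le> l \<Longrightarrow> colourable G l"
  unfolding colourable_def by (meson less_le_trans)

lemma colourable_delete_vertices: "colourable G k \<Longrightarrow> colourable (delete_vertices G I) k"
  unfolding colourable_def delete_vertices_def by fastforce

text \<open>An injective numbering is a proper colouring, so the \<open>LEAST\<close> defining the
  chromatic number is attained.\<close>

lemma finite_imp_colourable:
  assumes "pair_graph G"
  shows "\<exists>k. colourable G k"
proof -
  interpret pair_graph G by fact
  obtain h where h: "bij_betw h (pverts G) {0..<card (pverts G)}"
    using ex_bij_betw_finite_nat pair_finite_verts by blast
  have "h u \<noteq> h v" if "(u, v) \<in> parcs G" for u v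
    using that h wellformed'[OF that] no_loops'[OF that] by (auto simp: bij_betw_def inj_on_def)
  then show ?thesis
    using h unfolding colourable_def bij_betw_def by (intro exI[of _ "card (pverts G)"] exI[of _ h]) auto
qed

lemma colourable_chromatic_number: "colourable G k \<Longrightarrow> colourable G (chromatic_number G)"
  unfolding chromatic_number_def by (rule LeastI)

lemma chromatic_number_le: "colourable G k \<Longrightarrow> chromatic_number G \<le> k"
  unfolding chromatic_number_def by (rule Least_le)

lemma colourable_copy:
  assumes "contains_copy G F" "colourable G k"
  shows "colourable F k"
proof -
  obtain f where f: "f ` pverts F \<subseteq> pverts G" "\<forall>(u, v) \<in> parcs F. (f u, f v) \<in> parcs G"
    using assms(1) by (auto simp: contains_copy_def)
  obtain c where c: "\<forall>v \<in> pverts G. c v < k" "\<forall>(u, v) \<in> parcs G. c u \<noteq> c v"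
    using assms(2) by (auto simp: colourable_def)
  have "c (f u) \<noteq> c (f v)" if "(u, v) \<in> parcs F" for u v
    using f(2) c(2) that by blast
  then show ?thesis unfolding colourable_def using f c
    by (intro exI[of _ "c \<circ> f"]) auto
qed

text \<open>Deleting a colour class shows that \<^const>\<open>indep_reduction\<close> is a minimum over a nonempty set.\<close>

lemma indep_reduction_1_obtains:
  assumes F: "pair_graph F" and chi: "chromatic_number F = r + 1" and a: "indep_reduction F = 1"
  obtains v0 where "v0 \<in> pverts F" "colourable (delete_vertices F {v0}) r"
proof -
  interpret pair_graph F by fact
  define J where "J = {I. independent_set F I \<and>
                     chromatic_number (delete_vertices F I) \<le> chromatic_number F - 1}"
  have "J \<subseteq> Pow (pverts F)" by (auto simp: J_def independent_set_def)
  then have fin: "finite J" using pair_finite_verts by (simp add: finite_subset)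
  obtain k where k: "colourable F k" using finite_imp_colourable[OF F] by blast
  then have "colourable F (r + 1)" using colourable_chromatic_number chi by metis
  then obtain c where c: "\<And>v. v \<in> pverts F \<Longrightarrow> c v < r + 1" "\<And>u v. (u, v) \<in> parcs F \<Longrightarrow> c u \<noteq> c v"
    unfolding colourable_def by blast
  define I where "I = {v \<in> pverts F. c v = r}"
  have "c v < r" if "v \<in> pverts F" "v \<notin> I" for v
    using c(1)[OF that(1)] that by (auto simp: I_def)
  then have "colourable (delete_vertices F I) r"
    unfolding colourable_def delete_vertices_def using c(2) by (intro exI[of _ c]) auto
  then have "I \<in> J"
    using chromatic_number_le c(2) chi by (fastforce simp: J_def independent_set_def I_def)
  then have "Min (card ` J) \<in> card ` J" using fin by (intro Min_in) auto
  then have "1 \<in> card ` J" using a by (simp add: indep_reduction_def J_def)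
  then obtain I' where I': "I' \<in> J" "card I' = 1" by auto
  then obtain v0 where v0: "I' = {v0}" by (auto simp: card_1_singleton_iff)
  have le: "chromatic_number (delete_vertices F {v0}) \<le> r" and "v0 \<in> pverts F"
    using I' v0 chi by (auto simp: J_def independent_set_def)
  moreover have "colourable (delete_vertices F {v0}) r"
    using colourable_mono[OF colourable_chromatic_number[OF colourable_delete_vertices[OF k]] le] .
  ultimately show thesis using that by blast
qed

text \<open>Send \<open>v0\<close> to \<open>x\<close> and each colour class of the rest into its
  own part; parts as large as the whole vertex set of \<open>F\<close> leave room for any
  class.\<close>

lemma multipartite_nbhd_imp_copy:
  assumes F: "pair_graph F" and G: "pair_graph G" and v0: "v0 \<in> pverts F"
    and col: "colourable (delete_vertices F {v0}) q"
    and mp: "contains_multipartite {w. (x, w) \<in> parcs G} (parcs G) q (card (pverts F))"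
    and x: "x \<in> pverts G"
  shows "contains_copy G F"
proof -
  interpret F: pair_graph F by fact
  interpret G: pair_graph G by fact
  obtain c where c: "\<And>v. v \<in> pverts F \<Longrightarrow> v \<noteq> v0 \<Longrightarrow> c v < q"
    "\<And>u v. (u, v) \<in> parcs F \<Longrightarrow> u \<noteq> v0 \<Longrightarrow> v \<noteq> v0 \<Longrightarrow> c u \<noteq> c v"
  proof -
    obtain c where "\<forall>v\<in>pverts F - {v0}. c v < q"
      "\<forall>(u, v)\<in>{(u, v) \<in> parcs F. u \<notin> {v0} \<and> v \<notin> {v0}}. c u \<noteq> c v"
      using col unfolding colourable_def delete_vertices_def by auto
    then show thesis by (intro that[of c]) auto
  qed
  obtain T where T: "\<And>i w. i < q \<Longrightarrow> w \<in> T i \<Longrightarrow> (x, w) \<in> parcs G" "\<And>i. i < q \<Longrightarrow> card (T i) = card (pverts F)"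
    "\<And>i j u w. i < q \<Longrightarrow> j < q \<Longrightarrow> i \<noteq> j \<Longrightarrow> u \<in> T i \<Longrightarrow> w \<in> T j \<Longrightarrow> (u, w) \<in> parcs G"
  proof -
    obtain T where T: "\<forall>i<q. T i \<subseteq> {w. (x, w) \<in> parcs G} \<and> card (T i) = card (pverts F)"
      "\<forall>i<q. \<forall>j<q. i \<noteq> j \<longrightarrow> T i \<times> T j \<subseteq> parcs G"
      using mp unfolding contains_multipartite_def by (elim exE conjE)
    show thesis
    proof (rule that[of T])
      show "(x, w) \<in> parcs G" if "i < q" "w \<in> T i" for i w using T(1) that by auto
      show "card (T i) = card (pverts F)" if "i < q" for i using T(1) that by auto
      show "(u, w) \<in> parcs G" if "i < q" "j < q" "i \<noteq> j" "u \<in> T i" "w \<in> T j" for i j u w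
        using T(2)[rule_format, OF that(1-3)] that(4,5) by auto
    qed
  qed
  have "card (pverts F) > 0" using v0 F.pair_finite_verts by (auto simp: card_gt_0_iff)
  \<comment> \<open>A bijection on all vertices of \<open>F\<close>, though it is only used on
    colour class \<open>i\<close>; this avoids counting the classes.\<close>
  define h where "h i = (SOME h. bij_betw h (pverts F) (T i))" for i
  have h: "bij_betw (h i) (pverts F) (T i)" if i: "i < q" for i
  proof -
    have "finite (T i)" using T(2)[OF i] \<open>card (pverts F) > 0\<close> by (intro card_ge_0_finite) simp
    then have "\<exists>h. bij_betw h (pverts F) (T i)"
      using T(2)[OF i] F.pair_finite_verts by (intro finite_same_card_bij) simp_all
    then show ?thesis unfolding h_def by (rule someI_ex)
  qed
  define f where "f u = (if u = v0 then x else h (c u) u)" for u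
  have fT: "f u \<in> T (c u)" if "u \<in> pverts F" "u \<noteq> v0" for u
    using h[OF c(1)[OF that]] that by (auto simp: f_def bij_betw_def)
  \<comment> \<open>Claimed for all pairs not sharing a colour class, not only for arcs of
    \<open>F\<close>: as \<open>G\<close> is loopless, adjacency then also gives injectivity across
    classes.\<close>
  have edge: "(f u, f v) \<in> parcs G" if uv: "u \<in> pverts F" "v \<in> pverts F" "u = v0 \<or> v = v0 \<or> c u \<noteq> c v" "u \<noteq> v" for u v
  proof -
    consider "u = v0" "v \<noteq> v0" | "v = v0" "u \<noteq> v0" | "u \<noteq> v0" "v \<noteq> v0" "c u \<noteq> c v" using uv by blast
    then show ?thesis
    proof cases
      case 1
      then show ?thesis using T(1)[OF c(1) fT, of v] that by (simp add: f_def[of v0])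
    next
      case 2
      then show ?thesis using T(1)[OF c(1) fT, of u] that G.arcs_symmetric by (simp add: f_def[of v0])
    next
      case 3
      then show ?thesis using T(3)[OF c(1) c(1) _ fT fT, of u v] that by simp
    qed
  qed
  have "inj_on f (pverts F)"
  proof (rule inj_onI, rule ccontr)
    fix u v assume uv: "u \<in> pverts F" "v \<in> pverts F" "f u = f v" "u \<noteq> v"
    show False
    proof (cases "u = v0 \<or> v = v0 \<or> c u \<noteq> c v")
      case True
      then show False using edge[OF uv(1,2) _ uv(4)] uv(3) G.no_loops' by metis
    next
      case False
      then have "h (c u) u = h (c u) v" using uv by (simp add: f_def)
      moreover have "inj_on (h (c u)) (pverts F)"
        using h[OF c(1)[of u]] uv False by (auto simp: bij_betw_def)
      ultimately show False using uv by (auto dest: inj_onD)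
    qed
  qed
  moreover have "f u \<in> pverts G" if "u \<in> pverts F" for u
  proof (cases "u = v0")
    case False
    then show ?thesis using T(1)[OF c(1)[OF that] fT[OF that]] G.wellformed' by blast
  qed (simp add: f_def x)
  moreover have "(f u, f v) \<in> parcs G" if "(u, v) \<in> parcs F" for u v
    using edge[OF F.wellformed'[OF that]] c(2)[OF that] F.no_loops'[OF that] by blast
  ultimately show ?thesis unfolding contains_copy_def by (intro exI[of _ f]) auto
qed

section \<open>Degrees, arc counts and sizes of residue classes\<close>

lemma out_degree_eq_card: "out_degree (with_proj G) v = card {w. (v, w) \<in> parcs G}"
proof -
  have "out_arcs (with_proj G) v = Pair v ` {w. (v, w) \<in> parcs G}" by (auto simp: out_arcs_def)
  then show ?thesis unfolding out_degree_def by (simp add: card_image inj_on_def)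
qed

lemma card_parcs_eq_num_edges:
  fixes G :: "'a pair_pre_digraph"
  assumes "pair_graph G"
  shows "card (parcs G) = 2 * num_edges G"
proof -
  interpret pair_graph G by fact
  define g where "g = (\<lambda>(u, v). {u, v :: 'a})"
  have fib: "card {a. a \<in> parcs G \<and> g a = e} = 2" if e: "e \<in> g ` parcs G" for e
  proof -
    obtain a where "a \<in> parcs G" "e = g a" using e by blast
    then obtain u v where uv: "(u, v) \<in> parcs G" "e = {u, v}" by (cases a) (auto simp: g_def)
    then have "{a. a \<in> parcs G \<and> g a = e} = {(u, v), (v, u)}"
      using arcs_symmetric by (auto simp: g_def doubleton_eq_iff)
    then show ?thesis using no_loops'[OF uv(1)] by simp
  qed
  have "card (parcs G) = (\<Sum>e\<in>g ` parcs G. \<Sum>a | a \<in> parcs G \<and> g a = e. 1)"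
    using sum.image_gen[OF pair_finite_arcs, of "\<lambda>_. 1 :: nat" g] by simp
  also have "\<dots> = 2 * card (g ` parcs G)" using fib by simp
  also have "g ` parcs G = {{u, v} | u v. (u, v) \<in> parcs G}" by (auto simp: g_def)
  finally show ?thesis by (simp add: num_edges_def)
qed

lemma card_parcs_eq_sum:
  assumes "pair_graph G" "pverts G = V"
  shows "card (parcs G) = (\<Sum>u\<in>V. card {w. (u, w) \<in> parcs G})"
proof -
  interpret pair_graph G by fact
  have "parcs G = (SIGMA u:V. {w. (u, w) \<in> parcs G})"
    using in_arcsD1 assms(2) by auto
  moreover have "finite {w. (u, w) \<in> parcs G}" for u
    by (rule finite_subset[OF _ pair_finite_verts]) (use wellformed' in auto)
  moreover have "finite V" using assms(2) pair_finite_verts by simp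
  ultimately show ?thesis using card_SigmaI[of V "\<lambda>u. {w. (u, w) \<in> parcs G}"] by metis
qed

lemma card_residue_class:
  assumes "a < p"
  shows "m div p \<le> card {j. j < m \<and> j mod p = a}" "card {j. j < m \<and> j mod p = a} \<le> m div p + 1"
proof -
  have fin: "finite {j. j < m \<and> j mod p = a}" by simp
  have "inj_on (\<lambda>i. a + i * p) {..<m div p}" using assms by (auto simp: inj_on_def)
  moreover have "(\<lambda>i. a + i * p) ` {..<m div p} \<subseteq> {j. j < m \<and> j mod p = a}"
  proof safe
    fix i assume "i < m div p"
    then have "(i + 1) * p \<le> m" by (metis Suc_eq_plus1 Suc_leI div_times_less_eq_dividend mult_le_mono1 order_trans)
    then show "a + i * p < m" using assms by simp
  qed (use assms in auto)
  ultimately show "m div p \<le> card {j. j < m \<and> j mod p = a}"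
    using card_inj_on_le[OF _ _ fin] by fastforce
  have "inj_on (\<lambda>j. j div p) {j. j < m \<and> j mod p = a}"
    by (rule inj_onI) (metis (mono_tags, lifting) div_mult_mod_eq mem_Collect_eq)
  moreover have "(\<lambda>j. j div p) ` {j. j < m \<and> j mod p = a} \<subseteq> {..m div p}"
    by (auto intro: div_le_mono)
  ultimately show "card {j. j < m \<and> j mod p = a} \<le> m div p + 1"
    using card_inj_on_le[of _ _ "{..m div p}"] by fastforce
qed

text \<open>The condition \<open>(n - \<Delta>) * p \<le> \<Delta>\<close> is admissibility,
  \<open>\<Delta> \<ge> (r - 1) * n / r\<close>, without division: the edgeless part is at most as
  large as an average Turan part.\<close>

context
  fixes r n \<Delta> p :: nat
  assumes p: "p = r - 1" "1 \<le> p" and \<Delta>: "\<Delta> < n" "(n - \<Delta>) * p \<le> \<Delta>"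
begin

lemma pverts_S: "pverts (S_graph r n \<Delta>) = {..<n}"
  using \<Delta> by (auto simp: S_graph_def graph_join_def edgeless_graph_def turan_graph_def)

lemma parcs_S: "(i, j) \<in> parcs (S_graph r n \<Delta>) \<longleftrightarrow>
    i < \<Delta> \<and> j < \<Delta> \<and> i mod p \<noteq> j mod p \<or> \<Delta> \<le> i \<and> i < n \<and> j < \<Delta> \<or> i < \<Delta> \<and> \<Delta> \<le> j \<and> j < n"
  using p by (auto simp: S_graph_def graph_join_def edgeless_graph_def turan_graph_def)

lemma pair_graph_S: "pair_graph (S_graph r n \<Delta>)"
proof -
  have "parcs (S_graph r n \<Delta>) \<subseteq> {..<n} \<times> {..<n}" using \<Delta> by (auto simp: parcs_S)
  then have "finite (parcs (S_graph r n \<Delta>))" by (rule finite_subset) simp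
  moreover have "sym (parcs (S_graph r n \<Delta>))" by (rule symI) (auto simp: parcs_S)
  ultimately show ?thesis
    using \<Delta> by unfold_locales (auto simp: pverts_S parcs_S symmetric_def)
qed

lemma colourable_S: "colourable (S_graph r n \<Delta>) (p + 1)"
  unfolding colourable_def
\<comment> \<open>The Turan part keeps its residue classes and the edgeless part takes the extra
  colour \<open>p\<close>.\<close>
proof (intro exI[of _ "\<lambda>v. if v < \<Delta> then v mod p else p"] conjI ballI, safe)
  fix v show "(if v < \<Delta> then v mod p else p) < p + 1"
    using mod_less_divisor[of p v] p(2) by (auto simp del: mod_less_divisor)
next
  fix u v assume "(u, v) \<in> parcs (S_graph r n \<Delta>)"
    "(if u < \<Delta> then u mod p else p) = (if v < \<Delta> then v mod p else p)"
  moreover have "x mod p \<noteq> p" "p \<noteq> x mod p" for x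
    using mod_less_divisor[of p x] p(2) by linarith+
  ultimately show False by (auto simp: parcs_S split: if_splits)
qed

lemma degree_S_outer: "\<Delta> \<le> i \<Longrightarrow> i < n \<Longrightarrow> {j. (i, j) \<in> parcs (S_graph r n \<Delta>)} = {..<\<Delta>}"
  by (auto simp: parcs_S)

lemma degree_S_inner:
  assumes "i < \<Delta>"
  shows "{j. (i, j) \<in> parcs (S_graph r n \<Delta>)} = ({..<\<Delta>} - {j. j < \<Delta> \<and> j mod p = i mod p}) \<union> {\<Delta>..<n}"
  using assms by (auto simp: parcs_S)

lemma card_degree_S_inner:
  assumes "i < \<Delta>"
  shows "card {j. (i, j) \<in> parcs (S_graph r n \<Delta>)} = n - card {j. j < \<Delta> \<and> j mod p = i mod p}"
proof -
  have sub: "{j. j < \<Delta> \<and> j mod p = i mod p} \<subseteq> {..<\<Delta>}" by auto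
  have "card {j. (i, j) \<in> parcs (S_graph r n \<Delta>)}
      = card ({..<\<Delta>} - {j. j < \<Delta> \<and> j mod p = i mod p}) + card {\<Delta>..<n}"
    unfolding degree_S_inner[OF assms] by (rule card_Un_disjoint) auto
  moreover have "card {j. j < \<Delta> \<and> j mod p = i mod p} \<le> \<Delta>" using card_mono[OF _ sub] by simp
  ultimately show ?thesis using \<Delta> sub by (simp add: card_Diff_subset)
qed

text \<open>A Turan vertex misses exactly its own residue class, which by admissibility has at least
  \<open>n - \<Delta>\<close> elements; edgeless vertices have degree exactly
  \<open>\<Delta>\<close>, and one exists as \<open>\<Delta> < n\<close>.\<close>

lemma max_degree_S: "max_degree (S_graph r n \<Delta>) = \<Delta>"
  unfolding max_degree_def pverts_S
proof (rule Max_eqI)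
  fix d assume "d \<in> out_degree (with_proj (S_graph r n \<Delta>)) ` {..<n}"
  then obtain i where i: "i < n" "d = card {j. (i, j) \<in> parcs (S_graph r n \<Delta>)}"
    by (auto simp: out_degree_eq_card)
  show "d \<le> \<Delta>"
  proof (cases "i < \<Delta>")
    case True
    have "n - \<Delta> \<le> \<Delta> div p" using \<Delta>(2) p(2) by (simp add: less_eq_div_iff_mult_less_eq)
    also have "\<dots> \<le> card {j. j < \<Delta> \<and> j mod p = i mod p}"
      using card_residue_class(1) p(2) by simp
    finally show ?thesis using i card_degree_S_inner[OF True] by simp
  next
    case False
    then show ?thesis using i degree_S_outer by simp
  qed
next
  have "out_degree (with_proj (S_graph r n \<Delta>)) \<Delta> = \<Delta>"
    using \<Delta> degree_S_outer[of \<Delta>] by (simp add: out_degree_eq_card)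
  then show "\<Delta> \<in> out_degree (with_proj (S_graph r n \<Delta>)) ` {..<n}" using \<Delta> by force
qed simp

lemma card_inner_nbrs_S:
  assumes "i < \<Delta>"
  shows "(1 - 1 / real p) * real \<Delta> - 1 \<le> real (card {j. j < \<Delta> \<and> (i, j) \<in> parcs (S_graph r n \<Delta>)})"
proof -
  define R where "R = {j. j < \<Delta> \<and> j mod p = i mod p}"
  have R: "R \<subseteq> {..<\<Delta>}" "card R \<le> \<Delta> div p + 1"
    using card_residue_class(2)[of "i mod p" p] p(2) by (auto simp: R_def)
  have "{j. j < \<Delta> \<and> (i, j) \<in> parcs (S_graph r n \<Delta>)} = {..<\<Delta>} - R"
    using assms by (auto simp: parcs_S R_def)
  then have "real (card {j. j < \<Delta> \<and> (i, j) \<in> parcs (S_graph r n \<Delta>)}) = real \<Delta> - real (card R)"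
    using R(1) card_mono[OF _ R(1)] by (simp add: card_Diff_subset finite_subset of_nat_diff)
  moreover have "real (card R) \<le> real \<Delta> / real p + 1"
  proof -
    have "real (card R) \<le> real (\<Delta> div p) + 1" using R(2) by linarith
    also have "real (\<Delta> div p) \<le> real \<Delta> / real p" 
      using p(2) of_nat_mono[OF div_times_less_eq_dividend[of \<Delta> p], where ?'a = real]
      by (simp add: pos_le_divide_eq)
    finally show ?thesis by simp
  qed
  ultimately show ?thesis by (simp add: left_diff_distrib)
qed

text \<open>The term \<open>- real \<Delta>\<close> collects a rounding loss of 1 in the degree of
  each Turan vertex.\<close>

lemma num_edges_S:
  "2 * real (n - \<Delta>) * real \<Delta> + (1 - 1 / real p) * real \<Delta> ^ 2 - real \<Delta> \<le> 2 * real (num_edges (S_graph r n \<Delta>))"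
proof -
  let ?D = "\<lambda>u. card {w. (u, w) \<in> parcs (S_graph r n \<Delta>)}"
  have "2 * num_edges (S_graph r n \<Delta>) = (\<Sum>u\<in>{..<n}. ?D u)"
    using card_parcs_eq_sum[OF pair_graph_S pverts_S] card_parcs_eq_num_edges[OF pair_graph_S] by simp
  also have "{..<n} = {..<\<Delta>} \<union> {\<Delta>..<n}" using \<Delta> by auto
  also have "sum ?D \<dots> = sum ?D {..<\<Delta>} + sum ?D {\<Delta>..<n}" by (rule sum.union_disjoint) auto
  also have "sum ?D {\<Delta>..<n} = (n - \<Delta>) * \<Delta>" by (simp add: degree_S_outer)
  finally have eq: "2 * num_edges (S_graph r n \<Delta>) = sum ?D {..<\<Delta>} + (n - \<Delta>) * \<Delta>" .
  have "2 * real (num_edges (S_graph r n \<Delta>)) = (\<Sum>i<\<Delta>. real (?D i)) + real (n - \<Delta>) * real \<Delta>"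
    using arg_cong[OF eq, of real] by (simp only: of_nat_add of_nat_mult of_nat_sum of_nat_numeral)
  moreover have "(\<Sum>i<\<Delta>. (1 - 1 / real p) * real \<Delta> - 1 + real (n - \<Delta>)) \<le> (\<Sum>i<\<Delta>. real (?D i))"
  proof (rule sum_mono)
    fix i assume "i \<in> {..<\<Delta>}"
    then have i: "i < \<Delta>" by simp
    let ?N = "{j. j < \<Delta> \<and> (i, j) \<in> parcs (S_graph r n \<Delta>)}"
    have "{w. (i, w) \<in> parcs (S_graph r n \<Delta>)} = ?N \<union> {\<Delta>..<n}"
      using i by (auto simp: parcs_S)
    moreover have "card (?N \<union> {\<Delta>..<n}) = card ?N + card {\<Delta>..<n}"
      by (rule card_Un_disjoint) auto
    ultimately have "?D i = card ?N + (n - \<Delta>)" by simp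
    then show "(1 - 1 / real p) * real \<Delta> - 1 + real (n - \<Delta>) \<le> real (?D i)"
      using card_inner_nbrs_S[OF i] by simp
  qed
  ultimately show ?thesis by (simp add: power2_eq_square algebra_simps)
qed

end

lemma finite_free_graphs: "finite (free_graphs F n \<Delta>)"
proof (rule finite_subset)
  show "free_graphs F n \<Delta> \<subseteq> (\<lambda>E. \<lparr>pverts = {..<n}, parcs = E\<rparr>) ` Pow ({..<n} \<times> {..<n})"
  proof
    fix G assume G: "G \<in> free_graphs F n \<Delta>"
    then interpret pair_graph G by (simp add: free_graphs_def)
    have "G = \<lparr>pverts = {..<n}, parcs = parcs G\<rparr>" using G by (simp add: free_graphs_def)
    moreover have "parcs G \<subseteq> {..<n} \<times> {..<n}" using G wellformed' by (auto simp: free_graphs_def)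
    ultimately show "G \<in> (\<lambda>E. \<lparr>pverts = {..<n}, parcs = E\<rparr>) ` Pow ({..<n} \<times> {..<n})" by blast
  qed
qed simp

section \<open>Spectral radius of adjacency matrices\<close>

lemma adjacency_matrix_eq:
  assumes "pverts G = {..<n}"
  shows "adjacency_matrix G = mat n n (\<lambda>(i, j). if (i, j) \<in> parcs G then 1 else 0)"
proof -
  have "sorted_list_of_set {..<n} = [0..<n]"
    by (simp add: lessThan_atLeast0)
  then show ?thesis
    unfolding adjacency_matrix_def Let_def assms by (auto intro!: eq_matI)
qed

lemma adjacency_mult_vec:
  assumes "pverts G = {..<n}" "x \<in> carrier_vec n" "i < n"
  shows "(adjacency_matrix G *\<^sub>v x) $ i = (\<Sum>j<n. if (i, j) \<in> parcs G then x $ j else 0)"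
proof -
  have "(adjacency_matrix G *\<^sub>v x) $ i = (\<Sum>j = 0..<n. (if (i, j) \<in> parcs G then 1 else 0) * x $ j)"
    using assms by (simp add: adjacency_matrix_eq[OF assms(1)] scalar_prod_def)
  also have "\<dots> = (\<Sum>j<n. if (i, j) \<in> parcs G then x $ j else 0)"
    by (intro sum.cong) auto
  finally show ?thesis .
qed

lemma adjacency_matrix_carrier: "pverts G = {..<n} \<Longrightarrow> adjacency_matrix G \<in> carrier_mat n n"
  by (simp add: adjacency_matrix_eq)

text \<open>Take the moduli of the entries of an eigenvector to an eigenvalue of largest modulus;
  the triangle inequality gives the row inequalities, a weak form of Perron--Frobenius.\<close>

lemma graph_rho_subeigenvector:
  assumes V: "pverts G = {..<n}" and n: "0 < n"
  obtains y :: "nat \<Rightarrow> real" where "\<And>i. 0 \<le> y i" "(\<Sum>i<n. (y i)\<^sup>2) = 1"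
    "\<And>i. i < n \<Longrightarrow> graph_rho G * y i \<le> (\<Sum>j<n. if (i, j) \<in> parcs G then y j else 0)"
    "0 \<le> graph_rho G"
proof -
  let ?A = "adjacency_matrix G"
  have A: "?A \<in> carrier_mat n n" by (rule adjacency_matrix_carrier[OF V])
  obtain ev where ev: "ev \<in> spectrum ?A" "graph_rho G = norm ev"
    using spectral_radius_mem_max(1)[OF A n] by (auto simp: graph_rho_def)
  then obtain x where "eigenvector ?A x ev" by (auto simp: spectrum_def eigenvalue_def)
  then have x: "x \<in> carrier_vec n" "x \<noteq> 0\<^sub>v n" "?A *\<^sub>v x = ev \<cdot>\<^sub>v x"
    using A by (auto simp: eigenvector_def)
  define s where "s = (\<Sum>i<n. (norm (x $ i))\<^sup>2)"
  have "\<exists>i<n. x $ i \<noteq> 0" using x(1,2) by (metis carrier_vecD eq_vecI index_zero_vec)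
  then obtain i0 where i0: "i0 < n" "x $ i0 \<noteq> 0" by blast
  have "0 < (norm (x $ i0))\<^sup>2" using i0 by simp
  also have "\<dots> \<le> s" unfolding s_def using i0 by (intro member_le_sum) auto
  finally have s: "0 < s" .
  define y where "y i = norm (x $ i) / sqrt s" for i
  show thesis
  proof (rule that[of y])
    show "0 \<le> y i" for i using s by (simp add: y_def)
    show "(\<Sum>i<n. (y i)\<^sup>2) = 1"
      using s by (simp add: y_def power_divide sum_divide_distrib[symmetric] s_def[symmetric])
    show "0 \<le> graph_rho G" using ev by simp
    fix i assume i: "i < n"
    have "graph_rho G * norm (x $ i) = norm ((?A *\<^sub>v x) $ i)"
      using i x(1) by (simp add: x(3) ev norm_mult)
    also have "\<dots> \<le> (\<Sum>j<n. norm (if (i, j) \<in> parcs G then x $ j else 0))"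
      unfolding adjacency_mult_vec[OF V x(1) i] by (rule norm_sum)
    also have "\<dots> = (\<Sum>j<n. if (i, j) \<in> parcs G then norm (x $ j) else 0)"
      by (intro sum.cong) auto
    finally have "graph_rho G * norm (x $ i) / sqrt s
        \<le> (\<Sum>j<n. if (i, j) \<in> parcs G then norm (x $ j) else 0) / sqrt s"
      using s by (intro divide_right_mono) auto
    also have "\<dots> = (\<Sum>j<n. if (i, j) \<in> parcs G then y j else 0)"
      unfolding sum_divide_distrib by (intro sum.cong) (auto simp: y_def)
    finally show "graph_rho G * y i \<le> (\<Sum>j<n. if (i, j) \<in> parcs G then y j else 0)"
      by (simp add: y_def)
  qed
qed

text \<open>A nonnegative matrix preserves entrywise domination and, by the hypothesis on
  \<open>w\<close>, raises the dominated multiple of \<open>w\<close> by the factor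
  \<open>\<theta>\<close>. The induction varies \<open>s\<close> and \<open>z\<close>, since each
  step replaces \<open>z\<close> by its image; \<open>z'\<close> records that the entry stays
  real.\<close>

lemma matrix_power_growth:
  fixes B :: "complex mat" and b :: "nat \<Rightarrow> nat \<Rightarrow> real" and w z :: "nat \<Rightarrow> real"
  assumes B: "B \<in> carrier_mat n n" and Bb: "\<And>i j. i < n \<Longrightarrow> j < n \<Longrightarrow> B $$ (i, j) = of_real (b i j)"
    and b: "\<And>i j. 0 \<le> b i j" and \<theta>: "0 \<le> \<theta>"
    and w: "\<And>i. i < n \<Longrightarrow> \<theta> * w i \<le> (\<Sum>j<n. b i j * w j)"
    and s: "0 \<le> s" and z: "\<And>i. i < n \<Longrightarrow> s * w i \<le> z i" and i: "i < n"
  shows "\<exists>z'. (B ^\<^sub>m k *\<^sub>v vec n (\<lambda>i. of_real (z i))) $ i = of_real z' \<and> s * \<theta> ^ k * w i \<le> z'"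
  using s z
proof (induction k arbitrary: s z)
  case 0
  then show ?case using i B by (intro exI[of _ "z i"]) simp
next
  case (Suc k)
  define z2 where "z2 i = (\<Sum>j<n. b i j * z j)" for i
  have Bz: "B *\<^sub>v vec n (\<lambda>i. of_real (z i)) = vec n (\<lambda>i. of_real (z2 i))"
  proof (rule eq_vecI)
    fix i assume "i < dim_vec (vec n (\<lambda>i. complex_of_real (z2 i)))"
    then have i: "i < n" by simp
    have "(B *\<^sub>v vec n (\<lambda>i. of_real (z i))) $ i = (\<Sum>j = 0..<n. B $$ (i, j) * of_real (z j))"
      using i B by (simp add: scalar_prod_def)
    also have "\<dots> = (\<Sum>j<n. of_real (b i j * z j))"
      using i by (intro sum.cong) (auto simp: Bb)
    finally show "(B *\<^sub>v vec n (\<lambda>i. of_real (z i))) $ i = vec n (\<lambda>i. complex_of_real (z2 i)) $ i"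
      using i by (simp add: z2_def)
  qed (use B in simp)
  have "s * \<theta> * w i \<le> z2 i" if "i < n" for i
  proof -
    have "s * \<theta> * w i \<le> s * (\<Sum>j<n. b i j * w j)"
      using w[OF that] Suc.prems(1) by (simp add: mult.assoc mult_left_mono)
    also have "\<dots> = (\<Sum>j<n. b i j * (s * w j))"
      by (simp add: sum_distrib_left mult.left_commute)
    also have "\<dots> \<le> z2 i" unfolding z2_def
      using Suc.prems(2) b by (intro sum_mono mult_left_mono) auto
    finally show ?thesis .
  qed
  moreover have "0 \<le> s * \<theta>" using Suc.prems \<theta> by simp
  ultimately obtain z' where z': "(B ^\<^sub>m k *\<^sub>v vec n (\<lambda>i. of_real (z2 i))) $ i = of_real z'"
    "s * \<theta> * \<theta> ^ k * w i \<le> z'"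
    using Suc.IH by blast
  have "B ^\<^sub>m Suc k *\<^sub>v vec n (\<lambda>i. of_real (z i)) = B ^\<^sub>m k *\<^sub>v (B *\<^sub>v vec n (\<lambda>i. of_real (z i)))"
    using B by (simp add: assoc_mult_mat_vec[of _ n n _ n])
  then show ?case using z' by (intro exI[of _ z']) (simp add: Bz mult.assoc)
qed

text \<open>If the spectral radius were below \<open>\<mu>\<close>, then the powers of the rescaled matrix would be
  bounded, but they make a positive vector grow exponentially.\<close>

lemma graph_rho_ge:
  fixes w :: "nat \<Rightarrow> real"
  assumes V: "pverts G = {..<n}" and n: "0 < n"
    and w: "\<And>i. i < n \<Longrightarrow> 0 < w i"
    and \<mu>: "\<And>i. i < n \<Longrightarrow> \<mu> * w i \<le> (\<Sum>j<n. if (i, j) \<in> parcs G then w j else 0)"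
  shows "\<mu> \<le> graph_rho G"
proof (rule ccontr)
  let ?A = "adjacency_matrix G"
  assume "\<not> \<mu> \<le> graph_rho G"
  have A: "?A \<in> carrier_mat n n" by (rule adjacency_matrix_carrier[OF V])
  have \<rho>0: "0 \<le> graph_rho G" using graph_rho_subeigenvector[OF V n] by metis
  \<comment> \<open>Strictly between the two: dividing by \<open>\<beta>\<close> pushes the spectral
    radius below 1 while the growth factor \<open>\<mu> / \<beta>\<close> stays above 1.\<close>
  define \<beta> where "\<beta> = (graph_rho G + \<mu>) / 2"
  have \<beta>: "graph_rho G < \<beta>" "\<beta> < \<mu>" "0 < \<beta>"
    using \<open>\<not> \<mu> \<le> graph_rho G\<close> \<rho>0 by (auto simp: \<beta>_def)
  define B where "B = complex_of_real (1 / \<beta>) \<cdot>\<^sub>m ?A"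
  have B: "B \<in> carrier_mat n n" using A by (simp add: B_def)
  have "norm e < 1" if e: "e \<in> spectrum B" for e
  proof -
    obtain x where x: "x \<in> carrier_vec n" "x \<noteq> 0\<^sub>v n" "B *\<^sub>v x = e \<cdot>\<^sub>v x"
      using e B by (auto simp: spectrum_def eigenvalue_def eigenvector_def)
    have "?A = complex_of_real \<beta> \<cdot>\<^sub>m B" using \<beta> by (auto simp: B_def intro!: eq_matI)
    then have "?A *\<^sub>v x = complex_of_real \<beta> \<cdot>\<^sub>v (B *\<^sub>v x)"
      using B x(1) by (intro eq_vecI) (simp_all add: scalar_prod_def sum_distrib_left mult.assoc)
    then have "?A *\<^sub>v x = (complex_of_real \<beta> * e) \<cdot>\<^sub>v x" by (simp add: x(3) smult_smult_assoc)
    then have "complex_of_real \<beta> * e \<in> spectrum ?A"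
      using x A by (auto simp: spectrum_def eigenvalue_def eigenvector_def)
    then have "norm (complex_of_real \<beta> * e) \<le> graph_rho G"
      using spectral_radius_mem_max(2)[OF A n] by (simp add: graph_rho_def)
    moreover have "norm (complex_of_real \<beta> * e) = \<beta> * norm e" using \<beta> by (simp add: norm_mult)
    ultimately have "\<beta> * norm e < \<beta> * 1" using \<beta> by linarith
    then show ?thesis using \<beta> by (simp only: mult_less_cancel_left_pos)
  qed
  then have "spectral_radius B < 1" using spectral_radius_mem_max(1)[OF B n] by auto
  \<comment> \<open>A spectral radius below 1 bounds the entries of all powers by one
    constant.\<close>
  then obtain c where c: "\<And>k. norm_bound (B ^\<^sub>m k) c"
    using spectral_radius_jnf_norm_bound_less_1_upper_triangular[OF B] by blast
  define \<theta> where "\<theta> = \<mu> / \<beta>"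
  have \<theta>: "1 < \<theta>" using \<beta> by (simp add: \<theta>_def)
  define b where "b i j = (if (i, j) \<in> parcs G then 1 / \<beta> else 0)" for i j
  have Bb: "B $$ (i, j) = of_real (b i j)" if "i < n" "j < n" for i j
    using that by (simp add: B_def adjacency_matrix_eq[OF V] b_def)
  have b0: "0 \<le> b i j" for i j using \<beta> by (simp add: b_def)
  have \<theta>0: "0 \<le> \<theta>" using \<theta> by simp
  have wb: "\<theta> * w i \<le> (\<Sum>j<n. b i j * w j)" if "i < n" for i
  proof -
    have "\<theta> * w i = \<mu> * w i / \<beta>" by (simp add: \<theta>_def)
    also have "\<dots> \<le> (\<Sum>j<n. if (i, j) \<in> parcs G then w j else 0) / \<beta>"
      using \<mu>[OF that] \<beta> by (simp add: divide_right_mono)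
    also have "\<dots> = (\<Sum>j<n. b i j * w j)"
      unfolding sum_divide_distrib by (intro sum.cong) (auto simp: b_def)
    finally show ?thesis .
  qed
  define C where "C = c * (\<Sum>j<n. w j)"
  have bound: "\<theta> ^ k * w 0 \<le> C" for k
  proof -
    let ?w = "vec n (\<lambda>i. complex_of_real (w i))"
    obtain z' where z': "(B ^\<^sub>m k *\<^sub>v ?w) $ 0 = of_real z'" "1 * \<theta> ^ k * w 0 \<le> z'"
      using matrix_power_growth[OF B Bb b0 \<theta>0 wb zero_le_one _ n, of w k] by auto
    have Bk: "B ^\<^sub>m k \<in> carrier_mat n n" using B by simp
    have "z' \<le> norm ((B ^\<^sub>m k *\<^sub>v ?w) $ 0)" unfolding z'(1) by simp
    also have "(B ^\<^sub>m k *\<^sub>v ?w) $ 0 = (\<Sum>j = 0..<n. (B ^\<^sub>m k) $$ (0, j) * of_real (w j))"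
    proof -
      have "(M *\<^sub>v vec n f) $ 0 = (\<Sum>j = 0..<n. M $$ (0, j) * f j)"
        if "M \<in> carrier_mat n n" for M :: "complex mat" and f
        using that n by (simp add: scalar_prod_def)
      then show ?thesis using Bk by blast
    qed
    also have "norm \<dots> \<le> (\<Sum>j = 0..<n. c * w j)"
    proof (rule order_trans[OF norm_sum sum_mono])
      fix j assume "j \<in> {0..<n}"
      then have j: "j < n" by simp
      have "norm ((B ^\<^sub>m k) $$ (0, j)) \<le> c"
        using c[of k] n j carrier_matD[OF Bk] unfolding norm_bound_def by metis
      then show "norm ((B ^\<^sub>m k) $$ (0, j) * complex_of_real (w j)) \<le> c * w j"
        using w[OF j] by (simp add: norm_mult mult_right_mono)
    qed
    also have "\<dots> = C" by (simp add: C_def sum_distrib_left lessThan_atLeast0)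
    finally show ?thesis using z'(2) by simp
  qed
  obtain k where "C / w 0 < \<theta> ^ k" using real_arch_pow[OF \<theta>] by blast
  then have "C < \<theta> ^ k * w 0" using w[OF n] by (simp add: pos_divide_less_eq)
  then show False using bound[of k] by simp
qed

section \<open>Quadratic forms with bounded outer degrees\<close>

text \<open>
  Here \<open>u\<close> is the weight of an outer vertex with \<open>s\<close> outer neighbours, \<open>W\<close> the weight of \<open>D - s\<close>
  vertices of \<open>A\<close> containing its neighbours there, and \<open>Z\<close> the weight of the remaining \<open>s\<close>
  vertices of \<open>A\<close>.
\<close>

lemma outer_vertex_bound:
  fixes D b s \<sigma> \<Lambda> W Z u q1 q2 :: real
  assumes D: "0 < D" and b: "0 < b" "b \<le> (1 - \<sigma>) * D" and s: "0 \<le> s" "s \<le> b"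
    and \<sigma>: "1 / 2 \<le> \<sigma>" and \<Lambda>: "0 < \<Lambda>" "\<Lambda>\<^sup>2 = \<sigma> * D * \<Lambda> + D * b"
    and W: "W\<^sup>2 \<le> (D - s) * q1" and Z: "Z\<^sup>2 \<le> s * q2" and q: "0 \<le> q1" "0 \<le> q2"
  shows "\<sigma> * (W + Z)\<^sup>2 + b * (2 * W * u + s * u\<^sup>2) \<le> \<Lambda> * (q1 + q2) + b * (\<Lambda> * u\<^sup>2)"
proof -
  have eq: "\<Lambda> * (\<Lambda> - \<sigma> * D) = D * b" using \<Lambda>(2) by (simp add: power2_eq_square algebra_simps)
  have "0 < \<Lambda> * (\<Lambda> - \<sigma> * D)" unfolding eq using D b by simp
  then have \<Lambda>1: "0 < \<Lambda> - \<sigma> * D" using \<Lambda>(1) by (simp add: zero_less_mult_iff)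
  \<comment> \<open>If \<open>\<Lambda>\<close> exceeded \<open>D\<close>, its product with
    \<open>\<Lambda> - \<sigma> * D\<close> would exceed \<open>D * b\<close>, because
    \<open>b \<le> (1 - \<sigma>) * D\<close>.\<close>
  have \<Lambda>D: "\<Lambda> \<le> D"
  proof (rule ccontr)
    assume "\<not> \<Lambda> \<le> D"
    then have "D * (\<Lambda> - \<sigma> * D) < \<Lambda> * (\<Lambda> - \<sigma> * D)" using \<Lambda>1 by (intro mult_strict_right_mono) auto
    moreover have "D * (D - \<sigma> * D) < D * (\<Lambda> - \<sigma> * D)" using \<open>\<not> \<Lambda> \<le> D\<close> D by simp
    moreover have "D * b \<le> D * (D - \<sigma> * D)" using b(2) D by (intro mult_left_mono) (auto simp: algebra_simps)
    ultimately show False using eq by linarith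
  qed
  have "D * b \<le> D * (\<Lambda> - \<sigma> * D)" unfolding eq[symmetric] using \<Lambda>D \<Lambda>1 by (intro mult_right_mono) auto
  then have b\<Lambda>: "b \<le> \<Lambda> - \<sigma> * D" using D by (simp only: mult_le_cancel_left_pos)
  have "0 < (1 - \<sigma>) * D" using b by linarith
  then have \<sigma>1: "\<sigma> < 1" using D by (simp add: zero_less_mult_iff)
  have \<sigma>s: "\<sigma> * s \<le> s" using mult_right_mono[of \<sigma> 1 s] s \<sigma>1 by simp
  have "0 < \<sigma> * D" using \<sigma> D by simp
  then have pos: "0 < \<Lambda> - s" "0 < \<Lambda> - \<sigma> * s" using b\<Lambda> s \<sigma>s by linarith+
  have "0 \<le> \<sigma>" using \<sigma> by simp
  have c1: "\<sigma> * (W + Z)\<^sup>2 \<le> \<sigma> * \<Lambda> / (\<Lambda> - \<sigma> * s) * W\<^sup>2 + \<Lambda> * q2"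
  proof (cases "s = 0")
    case True
    then have "Z = 0" using Z by simp
    then show ?thesis using True \<Lambda> q by simp
  next
    case False
    then have sp: "0 < \<sigma> * s" "0 < s" using s \<sigma> by simp_all
    \<comment> \<open>The Young parameter that gives \<open>Z\<^sup>2\<close> the coefficient
      \<open>\<Lambda> / s\<close>, which \<open>Z\<^sup>2 \<le> s * q2\<close> turns into
      \<open>\<Lambda> * q2\<close>.\<close>
    define \<kappa> where "\<kappa> = \<Lambda> - \<sigma> * s"
    have \<kappa>: "0 < \<kappa>" using pos by (simp add: \<kappa>_def)
    have "0 \<le> (\<sigma> * s * W - \<kappa> * Z)\<^sup>2" by simp
    then have "2 * (\<sigma> * s) * \<kappa> * (W * Z) \<le> (\<sigma> * s)\<^sup>2 * W\<^sup>2 + \<kappa>\<^sup>2 * Z\<^sup>2"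
      by (simp add: power2_diff power_mult_distrib algebra_simps)
    then have "(\<sigma> * s) * \<kappa> * (W + Z)\<^sup>2 \<le> (\<sigma> * s) * (\<kappa> + \<sigma> * s) * W\<^sup>2 + \<kappa> * (\<kappa> + \<sigma> * s) * Z\<^sup>2"
      by (simp add: power2_sum power2_eq_square algebra_simps)
    also have "\<kappa> + \<sigma> * s = \<Lambda>" by (simp add: \<kappa>_def)
    also have "\<kappa> * \<Lambda> * Z\<^sup>2 \<le> \<kappa> * \<Lambda> * (s * q2)" using Z \<kappa> \<Lambda> by (intro mult_left_mono) auto
    finally have "s * (\<kappa> * (\<sigma> * (W + Z)\<^sup>2)) \<le> s * (\<sigma> * \<Lambda> * W\<^sup>2 + \<kappa> * (\<Lambda> * q2))"
      by (simp add: algebra_simps)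
    then have "\<kappa> * (\<sigma> * (W + Z)\<^sup>2) \<le> \<sigma> * \<Lambda> * W\<^sup>2 + \<kappa> * (\<Lambda> * q2)"
      using sp by (simp only: mult_le_cancel_left_pos)
    then have "\<sigma> * (W + Z)\<^sup>2 \<le> (\<sigma> * \<Lambda> * W\<^sup>2 + \<kappa> * (\<Lambda> * q2)) / \<kappa>"
      using \<kappa> by (simp add: pos_le_divide_eq mult.commute)
    then show ?thesis using \<kappa> by (simp add: add_divide_distrib \<kappa>_def[symmetric])
  qed
  have c2: "b * (2 * W * u + s * u\<^sup>2) \<le> b / (\<Lambda> - s) * W\<^sup>2 + b * (\<Lambda> * u\<^sup>2)"
  proof -
    \<comment> \<open>Completing the square in \<open>u\<close>; the worst case is
      \<open>u = W / (\<Lambda> - s)\<close>.\<close>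
    have "0 \<le> (W - (\<Lambda> - s) * u)\<^sup>2" by simp
    then have "(\<Lambda> - s) * (2 * W * u + s * u\<^sup>2) \<le> W\<^sup>2 + (\<Lambda> - s) * (\<Lambda> * u\<^sup>2)"
      by (simp add: power2_eq_square algebra_simps)
    then have "2 * W * u + s * u\<^sup>2 \<le> (W\<^sup>2 + (\<Lambda> - s) * (\<Lambda> * u\<^sup>2)) / (\<Lambda> - s)"
      using pos by (simp add: pos_le_divide_eq mult.commute)
    also have "\<dots> = W\<^sup>2 / (\<Lambda> - s) + \<Lambda> * u\<^sup>2" using pos by (simp add: add_divide_distrib)
    finally have "b * (2 * W * u + s * u\<^sup>2) \<le> b * (W\<^sup>2 / (\<Lambda> - s) + \<Lambda> * u\<^sup>2)"
      using b by (intro mult_left_mono) auto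
    then show ?thesis by (simp add: distrib_left)
  qed
  \<comment> \<open>The total coefficient of \<open>W\<^sup>2\<close> left by both estimates. For
    \<open>s = 0\<close> the equation for \<open>\<Lambda>\<close> says
    \<open>K * D = \<Lambda>\<close>, so \<open>c3\<close> expresses that outer neighbours do not
    help.\<close>
  define K where "K = \<sigma> * \<Lambda> / (\<Lambda> - \<sigma> * s) + b / (\<Lambda> - s)"
  have "0 \<le> K" using \<open>0 \<le> \<sigma>\<close> \<Lambda> pos b by (simp add: K_def)
  have c3: "K * (D - s) \<le> \<Lambda>"
  proof -
    \<comment> \<open>The deficit in \<open>c3\<close> factors through this term, which is
      nonnegative by \<open>\<Lambda> - \<sigma> * D \<ge> b \<ge> \<sigma> * s\<close> and
      \<open>D \<le> 2 * \<sigma> * D\<close>; here \<open>1 / 2 \<le> \<sigma>\<close>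
      enters.\<close>
    have "0 \<le> \<Lambda> + \<sigma> * D - D - \<sigma> * s"
    proof -
      have "D / 2 \<le> \<sigma> * D" using mult_right_mono[OF \<sigma>, of D] D by simp
      then show ?thesis using b\<Lambda> s \<sigma>s by linarith
    qed
    then have "0 \<le> \<Lambda> * (s * (\<Lambda> - \<sigma> * D) * (\<Lambda> + \<sigma> * D - D - \<sigma> * s))"
      using s \<Lambda>1 \<Lambda> by simp
    also have "\<dots> = D * (\<Lambda> * (\<Lambda> - \<sigma> * s) * (\<Lambda> - s))
        - (D - s) * (D * \<sigma> * \<Lambda> * (\<Lambda> - s) + \<Lambda> * (\<Lambda> - \<sigma> * D) * (\<Lambda> - \<sigma> * s))"
      by (simp add: algebra_simps)
    also have "\<dots> = D * (\<Lambda> * ((\<Lambda> - \<sigma> * s) * (\<Lambda> - s)) - (D - s) * (\<sigma> * \<Lambda> * (\<Lambda> - s) + b * (\<Lambda> - \<sigma> * s)))"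
      unfolding eq by (simp add: algebra_simps)
    finally have "(\<sigma> * \<Lambda> * (\<Lambda> - s) + b * (\<Lambda> - \<sigma> * s)) * (D - s) \<le> \<Lambda> * ((\<Lambda> - \<sigma> * s) * (\<Lambda> - s))"
      using D by (simp add: zero_le_mult_iff mult.commute)
    moreover have "K = (\<sigma> * \<Lambda> * (\<Lambda> - s) + b * (\<Lambda> - \<sigma> * s)) / ((\<Lambda> - \<sigma> * s) * (\<Lambda> - s))"
      using pos by (simp add: K_def add_frac_eq)
    ultimately show ?thesis using pos by (simp add: pos_divide_le_eq)
  qed
  have "K * W\<^sup>2 \<le> K * ((D - s) * q1)" using W \<open>0 \<le> K\<close> by (rule mult_left_mono)
  also have "\<dots> \<le> \<Lambda> * q1" using c3 q by (simp add: mult.assoc[symmetric] mult_right_mono)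
  finally show ?thesis using c1 c2 by (simp add: K_def distrib_right distrib_left)
qed

text \<open>Each outer vertex contributes one instance of \<open>outer_vertex_bound\<close>; the
  terms belonging to \<open>A\<close> alone are shared equally among the \<open>card B\<close>
  instances. Arcs inside \<open>B\<close> are split between their ends by
  \<open>x i * x j \<le> ((x i)\<^sup>2 + (x j)\<^sup>2) / 2\<close>.\<close>

lemma quadratic_form_bound:
  fixes E :: "'a rel" and x :: "'a \<Rightarrow> real" and \<sigma> \<Lambda> :: real
  assumes fin: "finite A" "finite B" and disj: "A \<inter> B = {}" and E: "sym E"
    and x: "\<And>i. 0 \<le> x i" and B: "B \<noteq> {}"
    and deg: "\<And>i. i \<in> B \<Longrightarrow> card {j \<in> A \<union> B. (i, j) \<in> E} \<le> card A"
    and b: "real (card B) \<le> (1 - \<sigma>) * real (card A)" and \<sigma>: "1 / 2 \<le> \<sigma>"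
    and \<Lambda>: "0 < \<Lambda>" "\<Lambda>\<^sup>2 = \<sigma> * real (card A) * \<Lambda> + real (card A) * real (card B)"
  shows "(\<Sum>i\<in>A \<union> B. \<Sum>j\<in>A \<union> B. if (i, j) \<in> E then x i * x j else 0)
    \<le> (\<Sum>i\<in>A. \<Sum>j\<in>A. if (i, j) \<in> E then x i * x j else 0) - \<sigma> * (sum x A)\<^sup>2
      + \<Lambda> * (\<Sum>i\<in>A \<union> B. (x i)\<^sup>2)"
proof -
  define f where "f i j = (if (i, j) \<in> E then x i * x j else 0)" for i j
  define D where "D = real (card A)"
  define b' where "b' = real (card B)"
  have b': "0 < b'" using B fin by (simp add: b'_def card_gt_0_iff)
  have Epos: "(i, j) \<in> E \<longleftrightarrow> (j, i) \<in> E" for i j using E by (auto dest: symD)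
  have fsym: "f i j = f j i" for i j using Epos[of i j] by (simp add: f_def)
  have D: "0 < D"
  proof (rule ccontr)
    assume "\<not> 0 < D"
    then have "card A = 0" by (simp add: D_def)
    then show False using b b' by (simp add: b'_def)
  qed
  define s where "s i = card {j \<in> B. (i, j) \<in> E}" for i
  define N where "N i = {j \<in> A. (i, j) \<in> E}" for i
  have vertex: "\<sigma> * (sum x A)\<^sup>2 + b' * (2 * (\<Sum>j\<in>A. f i j) + real (s i) * (x i)\<^sup>2)
      \<le> \<Lambda> * (\<Sum>j\<in>A. (x j)\<^sup>2) + b' * (\<Lambda> * (x i)\<^sup>2)" if i: "i \<in> B" for i
  proof -
    have "{j \<in> A \<union> B. (i, j) \<in> E} = N i \<union> {j \<in> B. (i, j) \<in> E}" by (auto simp: N_def)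
    moreover have "card (N i \<union> {j \<in> B. (i, j) \<in> E}) = card (N i) + s i"
      unfolding s_def using fin disj by (intro card_Un_disjoint) (auto simp: N_def)
    ultimately have le: "card (N i) + s i \<le> card A" using deg[OF i] by simp
    \<comment> \<open>The degree bound leaves room to enlarge \<open>N i\<close> to exactly
      \<open>card A - s i\<close> vertices: each outer neighbour is paid for by one vertex of
      \<open>A\<close> left over.\<close>
    then have "card (N i) \<le> card A - s i" by simp
    from exists_subset_between[OF this _ _ fin(1)]
    obtain A1 where A1: "N i \<subseteq> A1" "A1 \<subseteq> A" "card A1 = card A - s i"
      by (auto simp: N_def)
    have finA1: "finite A1" "finite (A - A1)" using A1 fin finite_subset by auto
    have card2: "card (A - A1) = s i" using A1 fin finA1 le by (simp add: card_Diff_subset)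
    define W where "W = sum x A1"
    define Z where "Z = sum x (A - A1)"
    define q1 where "q1 = (\<Sum>j\<in>A1. (x j)\<^sup>2)"
    define q2 where "q2 = (\<Sum>j\<in>A - A1. (x j)\<^sup>2)"
    have split: "sum x A = W + Z" "(\<Sum>j\<in>A. (x j)\<^sup>2) = q1 + q2"
      unfolding W_def Z_def q1_def q2_def using sum.subset_diff[OF A1(2) fin(1)] by (simp_all add: add.commute)
    have W: "W\<^sup>2 \<le> (D - real (s i)) * q1"
      using sum_squared_le_sum_of_squares[of x A1] A1(3) le finA1
      by (simp add: W_def q1_def D_def of_nat_diff mult.commute)
    have Z: "Z\<^sup>2 \<le> real (s i) * q2"
      using sum_squared_le_sum_of_squares[of x "A - A1"] card2 finA1 by (simp add: Z_def q2_def mult.commute)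
    have "s i \<le> card B" unfolding s_def using fin by (intro card_mono) auto
    then have si: "0 \<le> real (s i)" "real (s i) \<le> b'" by (simp_all add: b'_def)
    have "(\<Sum>j\<in>A. f i j) = (\<Sum>j\<in>N i. x i * x j)"
      unfolding N_def f_def by (rule sum.inter_filter[OF fin(1), symmetric])
    also have "\<dots> \<le> (\<Sum>j\<in>A1. x i * x j)"
      by (rule sum_mono2) (use A1 finA1 x in auto)
    finally have "(\<Sum>j\<in>A. f i j) \<le> W * x i" by (simp add: W_def sum_distrib_left mult.commute)
    then have "b' * (2 * (\<Sum>j\<in>A. f i j) + real (s i) * (x i)\<^sup>2) \<le> b' * (2 * W * x i + real (s i) * (x i)\<^sup>2)"
      using b' by (intro mult_left_mono) auto
    moreover have "\<sigma> * (W + Z)\<^sup>2 + b' * (2 * W * x i + real (s i) * (x i)\<^sup>2)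
        \<le> \<Lambda> * (q1 + q2) + b' * (\<Lambda> * (x i)\<^sup>2)"
      using b \<Lambda> by (intro outer_vertex_bound[OF D b' _ si \<sigma> _ _ W Z])
        (auto simp: D_def b'_def q1_def q2_def intro: sum_nonneg)
    ultimately show ?thesis unfolding split by linarith
  qed
  \<comment> \<open>Summation over \<open>B\<close> multiplies the shared terms by \<open>b'\<close>
    as well, so this factor can be cancelled.\<close>
  have "(\<Sum>i\<in>B. \<sigma> * (sum x A)\<^sup>2 + b' * (2 * (\<Sum>j\<in>A. f i j) + real (s i) * (x i)\<^sup>2))
      \<le> (\<Sum>i\<in>B. \<Lambda> * (\<Sum>j\<in>A. (x j)\<^sup>2) + b' * (\<Lambda> * (x i)\<^sup>2))"
    by (rule sum_mono) (rule vertex)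
  then have "b' * (\<sigma> * (sum x A)\<^sup>2 + (\<Sum>i\<in>B. 2 * (\<Sum>j\<in>A. f i j) + real (s i) * (x i)\<^sup>2))
      \<le> b' * (\<Lambda> * (\<Sum>j\<in>A. (x j)\<^sup>2) + \<Lambda> * (\<Sum>i\<in>B. (x i)\<^sup>2))"
    by (simp add: sum.distrib b'_def distrib_left sum_distrib_left[symmetric] mult.left_commute)
  then have main: "\<sigma> * (sum x A)\<^sup>2 + (\<Sum>i\<in>B. 2 * (\<Sum>j\<in>A. f i j) + real (s i) * (x i)\<^sup>2)
      \<le> \<Lambda> * (\<Sum>j\<in>A. (x j)\<^sup>2) + \<Lambda> * (\<Sum>i\<in>B. (x i)\<^sup>2)"
    using b' by (simp only: mult_le_cancel_left_pos)
  have BB: "(\<Sum>i\<in>B. \<Sum>j\<in>B. f i j) \<le> (\<Sum>i\<in>B. real (s i) * (x i)\<^sup>2)"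
  proof -
    define g where "g i j = (if (i, j) \<in> E then (x i)\<^sup>2 / 2 else 0)" for i j
    have "f i j \<le> g i j + g j i" for i j
      using sum_squares_bound[of "x i" "x j"] Epos[of i j] by (simp add: f_def g_def)
    then have "(\<Sum>i\<in>B. \<Sum>j\<in>B. f i j) \<le> (\<Sum>i\<in>B. \<Sum>j\<in>B. g i j + g j i)"
      by (intro sum_mono)
    also have "\<dots> = (\<Sum>i\<in>B. \<Sum>j\<in>B. g i j) + (\<Sum>i\<in>B. \<Sum>j\<in>B. g j i)" by (simp add: sum.distrib)
    also have "(\<Sum>i\<in>B. \<Sum>j\<in>B. g j i) = (\<Sum>i\<in>B. \<Sum>j\<in>B. g i j)" by (rule sum.swap)
    also have "(\<Sum>i\<in>B. \<Sum>j\<in>B. g i j) + (\<Sum>i\<in>B. \<Sum>j\<in>B. g i j) = (\<Sum>i\<in>B. real (s i) * (x i)\<^sup>2)"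
    proof -
      have "(\<Sum>j\<in>B. g i j) = real (s i) * ((x i)\<^sup>2 / 2)" for i
        unfolding g_def s_def sum.inter_filter[OF fin(2), symmetric] by simp
      then show ?thesis unfolding sum.distrib[symmetric]
        by (intro sum.cong) (auto simp: sum_distrib_left[symmetric] mult.commute)
    qed
    finally show ?thesis .
  qed
  have AB: "(\<Sum>i\<in>A. \<Sum>j\<in>B. f i j) = (\<Sum>i\<in>B. \<Sum>j\<in>A. f i j)"
    by (subst sum.swap) (simp only: fsym)
  have "(\<Sum>i\<in>A \<union> B. \<Sum>j\<in>A \<union> B. f i j)
      = (\<Sum>i\<in>A. \<Sum>j\<in>A. f i j) + (\<Sum>i\<in>A. \<Sum>j\<in>B. f i j) + ((\<Sum>i\<in>B. \<Sum>j\<in>A. f i j) + (\<Sum>i\<in>B. \<Sum>j\<in>B. f i j))"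
    by (simp add: sum.union_disjoint[OF fin disj] sum.distrib)
  moreover have "(\<Sum>i\<in>B. 2 * (\<Sum>j\<in>A. f i j) + real (s i) * (x i)\<^sup>2)
      = 2 * (\<Sum>i\<in>B. \<Sum>j\<in>A. f i j) + (\<Sum>i\<in>B. real (s i) * (x i)\<^sup>2)"
    by (simp add: sum.distrib sum_distrib_left)
  moreover have "\<Lambda> * (\<Sum>i\<in>A \<union> B. (x i)\<^sup>2) = \<Lambda> * (\<Sum>j\<in>A. (x j)\<^sup>2) + \<Lambda> * (\<Sum>i\<in>B. (x i)\<^sup>2)"
    by (simp add: sum.union_disjoint[OF fin disj] distrib_left)
  ultimately show ?thesis using main BB AB unfolding f_def by linarith
qed

section \<open>Extremal bounds\<close>

text \<open>The positive root of \<open>x\<^sup>2 = (1 - 1/p) \<Delta> x + \<Delta> (n - \<Delta>)\<close>, the characteristic equation of the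
  quotient matrix of \<open>S\<close> for its partition into the edgeless part and the Turan part.\<close>

definition join_rho :: "nat \<Rightarrow> nat \<Rightarrow> nat \<Rightarrow> real" where
  "join_rho p n \<Delta> = ((1 - 1 / real p) * real \<Delta>
     + sqrt (((1 - 1 / real p) * real \<Delta>)\<^sup>2 + 4 * (real \<Delta> * real (n - \<Delta>)))) / 2"

lemma join_rho:
  assumes "1 \<le> p" "0 < \<Delta>" "\<Delta> < n"
  shows "0 < join_rho p n \<Delta>" "(1 - 1 / real p) * real \<Delta> \<le> join_rho p n \<Delta>"
    "(join_rho p n \<Delta>)\<^sup>2 = (1 - 1 / real p) * real \<Delta> * join_rho p n \<Delta> + real \<Delta> * real (n - \<Delta>)"
proof -
  define d where "d = (1 - 1 / real p) * real \<Delta>"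
  define c where "c = real \<Delta> * real (n - \<Delta>)"
  define q where "q = sqrt (d\<^sup>2 + 4 * c)"
  have d: "0 \<le> d" using assms by (simp add: d_def)
  have c: "0 < c" using assms by (simp add: c_def)
  have q2: "q\<^sup>2 = d\<^sup>2 + 4 * c" using c by (simp add: q_def)
  have "d < q" unfolding q_def by (rule real_less_rsqrt) (use c in simp)
  moreover have j: "join_rho p n \<Delta> = (d + q) / 2" by (simp add: join_rho_def d_def c_def q_def)
  ultimately show "0 < join_rho p n \<Delta>" "(1 - 1 / real p) * real \<Delta> \<le> join_rho p n \<Delta>"
    using d by (simp_all add: d_def[symmetric])
  show "(join_rho p n \<Delta>)\<^sup>2 = (1 - 1 / real p) * real \<Delta> * join_rho p n \<Delta> + real \<Delta> * real (n - \<Delta>)"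
    unfolding j d_def[symmetric] c_def[symmetric] using q2 by (simp add: power2_eq_square field_simps)
qed

text \<open>The test vector comes from the positive eigenvector of the quotient matrix. Edgeless
  rows are exact; in a Turan row the number of Turan neighbours falls short of
  \<open>(1 - 1 / p) * \<Delta>\<close> by at most one, whence the \<open>- 1\<close>.\<close>

lemma graph_rho_S_ge:
  assumes p: "p = r - 1" "1 \<le> p" and \<Delta>: "0 < \<Delta>" "\<Delta> < n" "(n - \<Delta>) * p \<le> \<Delta>"
  shows "join_rho p n \<Delta> - 1 \<le> graph_rho (S_graph r n \<Delta>)"
proof (rule graph_rho_ge)
  let ?S = "S_graph r n \<Delta>" and ?L = "join_rho p n \<Delta>"
  note L = join_rho[OF p(2) \<Delta>(1,2)]
  define w where "w i = (if i < \<Delta> then ?L else real \<Delta>)" for i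
  show "pverts ?S = {..<n}" by (rule pverts_S[OF p \<Delta>(2,3)])
  show "0 < n" using \<Delta> by simp
  show "0 < w i" for i using L(1) \<Delta> by (simp add: w_def)
  fix i assume i: "i < n"
  have split: "{..<n} = {..<\<Delta>} \<union> {\<Delta>..<n}" using \<Delta> by auto
  have "(\<Sum>j<n. if (i, j) \<in> parcs ?S then w j else 0)
      = (\<Sum>j<\<Delta>. if (i, j) \<in> parcs ?S then w j else 0) + (\<Sum>j=\<Delta>..<n. if (i, j) \<in> parcs ?S then w j else 0)"
    unfolding split by (rule sum.union_disjoint) auto
  also have "(\<Sum>j<\<Delta>. if (i, j) \<in> parcs ?S then w j else 0) = (\<Sum>j\<in>{j. j < \<Delta> \<and> (i, j) \<in> parcs ?S}. ?L)"
    using sum.inter_filter[of "{..<\<Delta>}" w "\<lambda>j. (i, j) \<in> parcs ?S"]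
    by (simp add: w_def cong: conj_cong)
  also have "(\<Sum>j=\<Delta>..<n. if (i, j) \<in> parcs ?S then w j else 0) = (if i < \<Delta> then real (n - \<Delta>) * real \<Delta> else 0)"
  proof -
    have "(\<Sum>j=\<Delta>..<n. if (i, j) \<in> parcs ?S then w j else 0) = (\<Sum>j=\<Delta>..<n. if i < \<Delta> then real \<Delta> else 0)"
      by (intro sum.cong) (auto simp: parcs_S[OF p \<Delta>(2,3)] w_def)
    then show ?thesis by simp
  qed
  finally have row: "(\<Sum>j<n. if (i, j) \<in> parcs ?S then w j else 0)
    = real (card {j. j < \<Delta> \<and> (i, j) \<in> parcs ?S}) * ?L + (if i < \<Delta> then real (n - \<Delta>) * real \<Delta> else 0)"
    by simp
  show "(?L - 1) * w i \<le> (\<Sum>j<n. if (i, j) \<in> parcs ?S then w j else 0)"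
  proof (cases "i < \<Delta>")
    case True
    have "((1 - 1 / real p) * real \<Delta> - 1) * ?L \<le> real (card {j. j < \<Delta> \<and> (i, j) \<in> parcs ?S}) * ?L"
      using card_inner_nbrs_S[OF p \<Delta>(2,3) True] L(1) by (intro mult_right_mono) auto
    then show ?thesis unfolding row using True L(3)
      by (simp add: w_def power2_eq_square algebra_simps)
  next
    case False
    then have "{j. j < \<Delta> \<and> (i, j) \<in> parcs ?S} = {..<\<Delta>}"
      using i by (auto simp: parcs_S[OF p \<Delta>(2,3)])
    then show ?thesis unfolding row using False by (simp add: w_def algebra_simps)
  qed
qed

section \<open>Members of the extremal family and their degrees\<close>

lemma S_in_free_graphs:
  assumes "chromatic_number F = r + 1" and p: "p = r - 1" "1 \<le> p" and \<Delta>: "\<Delta> < n" "(n - \<Delta>) * p \<le> \<Delta>"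
  shows "S_graph r n \<Delta> \<in> free_graphs F n \<Delta>"
proof -
  have "\<not> contains_copy (S_graph r n \<Delta>) F"
  proof
    assume "contains_copy (S_graph r n \<Delta>) F"
    then have "colourable F (p + 1)" using colourable_copy colourable_S[OF p \<Delta>] by blast
    then show False using chromatic_number_le[of F "p + 1"] assms(1) p by simp
  qed
  then show ?thesis
    using pair_graph_S[OF p \<Delta>] pverts_S[OF p \<Delta>] max_degree_S[OF p \<Delta>] by (simp add: free_graphs_def)
qed

lemma free_graphs_degree:
  assumes "G \<in> free_graphs F n \<Delta>" "0 < n"
  shows "i < n \<Longrightarrow> card {j. (i, j) \<in> parcs G} \<le> \<Delta>" "\<exists>v<n. card {j. (v, j) \<in> parcs G} = \<Delta>"
proof -
  define M where "M = (\<lambda>v. card {j. (v, j) \<in> parcs G}) ` {..<n}"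
  have "pverts G = {..<n}" "max_degree G = \<Delta>" using assms(1) by (simp_all add: free_graphs_def)
  then have Max: "Max M = \<Delta>" by (simp add: max_degree_def out_degree_eq_card M_def)
  have M: "finite M" "M \<noteq> {}" using assms(2) by (auto simp: M_def)
  show "card {j. (i, j) \<in> parcs G} \<le> \<Delta>" if "i < n"
    using Max_ge[OF M(1), of "card {j. (i, j) \<in> parcs G}"] that unfolding Max by (simp add: M_def)
  have "\<Delta> \<in> M" using Max_in[OF M] unfolding Max .
  then show "\<exists>v<n. card {j. (v, j) \<in> parcs G} = \<Delta>" by (auto simp: M_def)
qed

text \<open>The neighbourhood of a vertex of maximum degree contains no large complete \<open>r\<close>-partite graph,
  since together with the vertex this would contain \<open>F\<close>.\<close>

lemma sparse_neighbourhood: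
  fixes \<epsilon> :: real
  assumes F: "pair_graph F" and chi: "chromatic_number F = Suc p + 1" and a: "indep_reduction F = 1"
    and p: "1 \<le> p" and \<epsilon>: "0 < \<epsilon>"
  shows "\<exists>N. \<forall>n \<Delta> G. N \<le> \<Delta> \<longrightarrow> 0 < n \<longrightarrow> G \<in> free_graphs F n \<Delta> \<longrightarrow>
    (\<exists>A\<subseteq>{..<n}. card A = \<Delta> \<and> (\<forall>y. (\<forall>v\<in>A. 0 \<le> y v \<and> y v \<le> 1) \<longrightarrow>
      (\<Sum>u\<in>A. \<Sum>v\<in>A. if (u, v) \<in> parcs G then y u * y v else 0)
        \<le> (1 - 1 / real p) * (sum y A)\<^sup>2 + \<epsilon> * real \<Delta> ^ 2))"
proof -
  obtain v0 where v0: "v0 \<in> pverts F" "colourable (delete_vertices F {v0}) (Suc p)"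
    using indep_reduction_1_obtains[OF F chi a] by blast
  define t where "t = card (pverts F)"
  interpret F: pair_graph F by fact
  have "1 \<le> t" using v0(1) F.pair_finite_verts by (auto simp: t_def Suc_le_eq card_gt_0_iff)
  from weighted_erdos_stone[OF p this \<epsilon>]
  obtain N where N: "\<And>V E y. finite V \<Longrightarrow> N \<le> card V \<Longrightarrow> sym E \<Longrightarrow> irrefl E \<Longrightarrow>
    \<not> contains_multipartite V E (Suc p) t \<Longrightarrow> (\<forall>v\<in>V. 0 \<le> y v \<and> y v \<le> 1) \<Longrightarrow>
    (\<Sum>u\<in>V. \<Sum>v\<in>V. if (u, v) \<in> E then y u * y v else 0)
      \<le> (1 - 1 / real p) * (sum y (V :: nat set))\<^sup>2 + \<epsilon> * real (card V) ^ 2"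
    by blast
  show ?thesis
  proof (intro exI[of _ N] allI impI)
    fix n \<Delta> G assume \<Delta>: "N \<le> \<Delta>" "0 < n" and G: "G \<in> free_graphs F n \<Delta>"
    then have pG: "pair_graph G" and V: "pverts G = {..<n}" and free: "\<not> contains_copy G F"
      by (auto simp: free_graphs_def)
    interpret G: pair_graph G by fact
    obtain v where v: "v < n" "card {j. (v, j) \<in> parcs G} = \<Delta>"
      using free_graphs_degree(2)[OF G \<Delta>(2)] by blast
    define A where "A = {j. (v, j) \<in> parcs G}"
    have A: "A \<subseteq> {..<n}" "card A = \<Delta>" using G.in_arcsD2 V v by (auto simp: A_def)
    have "finite A" using A(1) finite_subset by blast
    have nm: "\<not> contains_multipartite A (parcs G) (Suc p) t"
      using multipartite_nbhd_imp_copy[OF F pG v0(1) v0(2), of v] free v V unfolding A_def t_def by auto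
    have sym: "sym (parcs G)" using G.arcs_symmetric by (auto intro: symI)
    have irr: "irrefl (parcs G)" using G.no_loops' by (auto simp: irrefl_def)
    show "\<exists>A\<subseteq>{..<n}. card A = \<Delta> \<and> (\<forall>y. (\<forall>v\<in>A. 0 \<le> y v \<and> y v \<le> 1) \<longrightarrow>
      (\<Sum>u\<in>A. \<Sum>v\<in>A. if (u, v) \<in> parcs G then y u * y v else 0)
        \<le> (1 - 1 / real p) * (sum y A)\<^sup>2 + \<epsilon> * real \<Delta> ^ 2)"
      using A N[OF \<open>finite A\<close> _ sym irr nm] \<Delta>(1) by (intro exI[of _ A]) auto
  qed
qed

text \<open>\<open>A\<close> stands for the neighbourhood of a vertex of maximum degree; of this
  origin only its size and the conclusion \<open>sparse\<close> of
  \<open>sparse_neighbourhood\<close> are kept.\<close>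

context
  fixes G :: "nat pair_pre_digraph" and A :: "nat set" and n \<Delta> p :: nat and \<epsilon> :: real
  assumes pG: "pair_graph G" and V: "pverts G = {..<n}"
    and deg: "\<And>i. i < n \<Longrightarrow> card {j. (i, j) \<in> parcs G} \<le> \<Delta>"
    and A: "A \<subseteq> {..<n}" "card A = \<Delta>" and \<epsilon>: "0 < \<epsilon>" and \<Delta>: "\<Delta> < n" "(n - \<Delta>) * p \<le> \<Delta>" and p: "2 \<le> p"
    and sparse: "\<And>y. (\<And>v. v \<in> A \<Longrightarrow> 0 \<le> y v \<and> y v \<le> 1) \<Longrightarrow>
      (\<Sum>u\<in>A. \<Sum>v\<in>A. if (u, v) \<in> parcs G then y u * y v else 0)
        \<le> (1 - 1 / real p) * (sum y A)\<^sup>2 + \<epsilon> * real \<Delta> ^ 2"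
begin

lemma nbhd_complement:
  shows "finite A" "finite ({..<n} - A)" "A \<inter> ({..<n} - A) = {}" "A \<union> ({..<n} - A) = {..<n}"
    "card ({..<n} - A) = n - \<Delta>" "real n \<le> 2 * real \<Delta>"
proof -
  show "finite A" using A(1) finite_subset by blast
  then show "card ({..<n} - A) = n - \<Delta>" using A by (simp add: card_Diff_subset)
  show "finite ({..<n} - A)" "A \<inter> ({..<n} - A) = {}" "A \<union> ({..<n} - A) = {..<n}" using A by auto
  have "(n - \<Delta>) * 1 \<le> (n - \<Delta>) * p" using p by (intro mult_le_mono) auto
  then show "real n \<le> 2 * real \<Delta>" using \<Delta> by linarith
qed

lemma card_nbrs_eq_sum:
  assumes "i < n"
  shows "(\<Sum>j<n. if (i, j) \<in> parcs G then 1 else 0) = real (card {j. (i, j) \<in> parcs G})"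
proof -
  interpret pair_graph G by (rule pG)
  have "{j. (i, j) \<in> parcs G} = {j \<in> {..<n}. (i, j) \<in> parcs G}" using in_arcsD2 V by auto
  then show ?thesis using sum.inter_filter[of "{..<n}" "\<lambda>_. 1 :: real" "\<lambda>j. (i, j) \<in> parcs G"] by simp
qed

text \<open>With weights 1, \<open>sparse\<close> bounds the arcs inside \<open>A\<close>. Every
  other arc has an end outside \<open>A\<close>, so twice the degree sum over the complement covers
  the rest.\<close>

lemma num_edges_upper:
  "2 * real (num_edges G) \<le> (1 - 1 / real p) * real \<Delta> ^ 2 + \<epsilon> * real \<Delta> ^ 2 + 2 * (real (n - \<Delta>) * real \<Delta>)"
proof -
  interpret pair_graph G by (rule pG)
  define B where "B = {..<n} - A"
  note R = nbhd_complement[folded B_def]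
  define f where "f i j = (if (i, j) \<in> parcs G then 1 else 0 :: real)" for i j
  have fsym: "f i j = f j i" for i j using arcs_symmetric by (auto simp: f_def)
  have f0: "0 \<le> f i j" for i j by (simp add: f_def)
  have "2 * num_edges G = (\<Sum>i<n. card {j. (i, j) \<in> parcs G})"
    using card_parcs_eq_num_edges[OF pG] card_parcs_eq_sum[OF pG V] by simp
  from arg_cong[OF this, of real]
  have "2 * real (num_edges G) = (\<Sum>i<n. real (card {j. (i, j) \<in> parcs G}))"
    by (simp only: of_nat_mult of_nat_numeral of_nat_sum)
  also have "\<dots> = (\<Sum>i<n. \<Sum>j<n. f i j)" unfolding f_def by (intro sum.cong) (simp_all add: card_nbrs_eq_sum)
  also have "\<dots> = (\<Sum>i\<in>A. \<Sum>j\<in>A. f i j) + (\<Sum>i\<in>A. \<Sum>j\<in>B. f i j) + (\<Sum>i\<in>B. \<Sum>j<n. f i j)"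
    unfolding R(4)[symmetric] by (simp add: sum.union_disjoint[OF R(1-3)] sum.distrib)
  also have "(\<Sum>i\<in>A. \<Sum>j\<in>B. f i j) = (\<Sum>i\<in>B. \<Sum>j\<in>A. f i j)" by (subst sum.swap) (simp only: fsym)
  also have "(\<Sum>i\<in>B. \<Sum>j\<in>A. f i j) \<le> (\<Sum>i\<in>B. \<Sum>j<n. f i j)"
    using A f0 by (intro sum_mono sum_mono2) auto
  finally have "2 * real (num_edges G) \<le> (\<Sum>i\<in>A. \<Sum>j\<in>A. f i j) + 2 * (\<Sum>i\<in>B. \<Sum>j<n. f i j)" by simp
  moreover have "(\<Sum>i\<in>B. \<Sum>j<n. f i j) \<le> (\<Sum>i\<in>B. real \<Delta>)"
    by (intro sum_mono) (use deg in \<open>auto simp: f_def card_nbrs_eq_sum B_def\<close>)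
  moreover have "(\<Sum>i\<in>B. real \<Delta>) = real (n - \<Delta>) * real \<Delta>" using R(5) by simp
  moreover have "(\<Sum>i\<in>A. \<Sum>j\<in>A. f i j) \<le> (1 - 1 / real p) * real \<Delta> ^ 2 + \<epsilon> * real \<Delta> ^ 2"
    using sparse[of "\<lambda>_. 1"] A(2) by (simp add: f_def cong: if_cong)
  ultimately show ?thesis by linarith
qed

text \<open>The subeigenvector bounds \<open>graph_rho\<close> by a quadratic form, which
  \<open>quadratic_form_bound\<close> reduces to the form on \<open>A\<close> and
  \<open>join_rho\<close>. For \<open>sparse\<close> the weights must be at most 1: a spectral
  radius of order \<open>n\<close> makes all entries \<open>O(1 / sqrt n)\<close>, and rescaling
  turns the error \<open>\<epsilon> * \<Delta>\<^sup>2\<close> into one linear in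
  \<open>n\<close>.\<close>

lemma graph_rho_upper: "graph_rho G \<le> join_rho p n \<Delta> + 16 * \<epsilon> * real n"
proof (rule ccontr)
  assume neg: "\<not> ?thesis"
  interpret pair_graph G by (rule pG)
  define B where "B = {..<n} - A"
  note R = nbhd_complement[folded B_def]
  let ?L = "join_rho p n \<Delta>" and ?\<rho> = "graph_rho G" and ?\<sigma> = "1 - 1 / real p"
  have n: "0 < n" "0 < \<Delta>" using \<Delta> R(6) by auto
  have p1: "1 \<le> p" using p by simp
  note L = join_rho[OF p1 n(2) \<Delta>(1)]
  have \<sigma>: "1 / 2 \<le> ?\<sigma>" using p by (simp add: field_simps)
  obtain y where y: "\<And>i. 0 \<le> y i" "(\<Sum>i<n. (y i)\<^sup>2) = 1"
    "\<And>i. i < n \<Longrightarrow> ?\<rho> * y i \<le> (\<Sum>j<n. if (i, j) \<in> parcs G then y j else 0)" "0 \<le> ?\<rho>"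
    using graph_rho_subeigenvector[OF V n(1)] by blast
  \<comment> \<open>The negated claim provides a linear lower bound on the spectral radius, via
    \<open>join_rho \<ge> \<Delta> / 2 \<ge> n / 4\<close>.\<close>
  have "0 \<le> 16 * \<epsilon> * real n" using \<epsilon> by simp
  then have "?L \<le> ?\<rho>" using neg by linarith
  moreover have "1 / 2 * real \<Delta> \<le> ?\<sigma> * real \<Delta>" using \<sigma> by (rule mult_right_mono) simp
  ultimately have \<rho>: "real n / 4 \<le> ?\<rho>" using L(2) R(6) by linarith
  \<comment> \<open>By Cauchy--Schwarz each row sum of \<open>y\<close> is at most
    \<open>sqrt n\<close>; dividing by \<open>n / 4\<close> bounds the entries by
    \<open>4 / sqrt n\<close>, the inverse of \<open>c\<close>.\<close>
  define c where "c = sqrt (real n) / 4"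
  have c: "0 < c" "c\<^sup>2 = real n / 16" using n by (simp_all add: c_def power_divide)
  have flat: "c * y i \<le> 1" if i: "i < n" for i
  proof -
    have "(?\<rho> * y i)\<^sup>2 \<le> (\<Sum>j<n. if (i, j) \<in> parcs G then y j else 0)\<^sup>2"
      using y i by (intro power_mono) auto
    also have "\<dots> \<le> (\<Sum>j<n. (if (i, j) \<in> parcs G then y j else 0)\<^sup>2) * real (card {..<n})"
      by (rule sum_squared_le_sum_of_squares)
    also have "\<dots> \<le> (\<Sum>j<n. (y j)\<^sup>2) * real n"
      by (intro mult_mono sum_mono) (auto intro: sum_nonneg)
    finally have 1: "(?\<rho> * y i)\<^sup>2 \<le> real n" using y(2) by simp
    have "(real n / 4 * y i)\<^sup>2 \<le> (?\<rho> * y i)\<^sup>2"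
      using \<rho> y(1) by (intro power_mono mult_right_mono) auto
    then have "(real n / 4 * y i)\<^sup>2 \<le> real n" using 1 by linarith
    then have "real n * (c * y i)\<^sup>2 \<le> real n * 1"
      unfolding power_mult_distrib c(2) by (simp add: power2_eq_square)
    then have "(c * y i)\<^sup>2 \<le> 1" using n by (simp only: mult_le_cancel_left_pos of_nat_0_less_iff)
    then show ?thesis by (simp add: abs_square_le_1)
  qed
  define Q where "Q = (\<Sum>u\<in>A. \<Sum>v\<in>A. if (u, v) \<in> parcs G then y u * y v else 0)"
  have "(\<Sum>u\<in>A. \<Sum>v\<in>A. if (u, v) \<in> parcs G then (c * y u) * (c * y v) else 0)
      \<le> ?\<sigma> * (\<Sum>v\<in>A. c * y v)\<^sup>2 + \<epsilon> * real \<Delta> ^ 2"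
    using c y(1) flat A(1) by (intro sparse) auto
  also have "(\<Sum>u\<in>A. \<Sum>v\<in>A. if (u, v) \<in> parcs G then (c * y u) * (c * y v) else 0) = c\<^sup>2 * Q"
    unfolding sum_distrib_left Q_def by (intro sum.cong) (auto simp: power2_eq_square)
  also have "(\<Sum>v\<in>A. c * y v)\<^sup>2 = c\<^sup>2 * (sum y A)\<^sup>2"
    by (simp add: sum_distrib_left[symmetric] power_mult_distrib)
  also have "?\<sigma> * (c\<^sup>2 * (sum y A)\<^sup>2) = c\<^sup>2 * (?\<sigma> * (sum y A)\<^sup>2)" by (rule mult.left_commute)
  finally have "c\<^sup>2 * Q \<le> c\<^sup>2 * (?\<sigma> * (sum y A)\<^sup>2) + \<epsilon> * real \<Delta> ^ 2" .
  moreover have "\<epsilon> * real \<Delta> ^ 2 \<le> \<epsilon> * real n ^ 2"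
    using \<epsilon> \<Delta> by (intro mult_left_mono power_mono) auto
  moreover have "\<epsilon> * real n ^ 2 = c\<^sup>2 * (16 * \<epsilon> * real n)"
    unfolding c(2) by (simp add: power2_eq_square)
  ultimately have "c\<^sup>2 * Q \<le> c\<^sup>2 * (?\<sigma> * (sum y A)\<^sup>2 + 16 * \<epsilon> * real n)"
    unfolding distrib_left by linarith
  then have Q: "Q \<le> ?\<sigma> * (sum y A)\<^sup>2 + 16 * \<epsilon> * real n"
    using c(1) by (simp only: mult_le_cancel_left_pos zero_less_power)
  \<comment> \<open>Weighting row \<open>i\<close> by \<open>y i\<close> and summing gives the
    Rayleigh bound, as \<open>y\<close> has norm 1.\<close>
  have "?\<rho> = (\<Sum>i<n. y i * (?\<rho> * y i))"
    using y(2) by (simp add: power2_eq_square sum_distrib_left[symmetric] mult.left_commute)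
  also have "\<dots> \<le> (\<Sum>i<n. y i * (\<Sum>j<n. if (i, j) \<in> parcs G then y j else 0))"
    using y by (intro sum_mono mult_left_mono) auto
  also have "\<dots> = (\<Sum>i<n. \<Sum>j<n. if (i, j) \<in> parcs G then y i * y j else 0)"
    unfolding sum_distrib_left by (intro sum.cong) auto
  finally have "?\<rho> \<le> (\<Sum>i<n. \<Sum>j<n. if (i, j) \<in> parcs G then y i * y j else 0)" .
  moreover have "(\<Sum>i\<in>A \<union> B. \<Sum>j\<in>A \<union> B. if (i, j) \<in> parcs G then y i * y j else 0)
    \<le> (\<Sum>i\<in>A. \<Sum>j\<in>A. if (i, j) \<in> parcs G then y i * y j else 0) - ?\<sigma> * (sum y A)\<^sup>2
      + ?L * (\<Sum>i\<in>A \<union> B. (y i)\<^sup>2)"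
  proof (rule quadratic_form_bound[OF R(1-3) _ y(1) _ _ _ \<sigma> L(1)])
    show "sym (parcs G)" using arcs_symmetric by (auto intro: symI)
    show "B \<noteq> {}" using R(5) \<Delta> by auto
    show "card {j \<in> A \<union> B. (i, j) \<in> parcs G} \<le> card A" if "i \<in> B" for i
    proof -
      have "{j \<in> A \<union> B. (i, j) \<in> parcs G} = {j. (i, j) \<in> parcs G}"
        unfolding R(4) using in_arcsD2 V by auto
      then show ?thesis using deg[of i] that A(2) by (simp add: B_def)
    qed
    have "real (n - \<Delta>) * real p \<le> real \<Delta>" using \<Delta>(2) by (metis of_nat_le_iff of_nat_mult)
    then have "real (n - \<Delta>) \<le> real \<Delta> / real p" using p by (simp add: pos_le_divide_eq)
    then show "real (card B) \<le> (1 - ?\<sigma>) * real (card A)" unfolding R(5) A(2) by simp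
    show "?L\<^sup>2 = ?\<sigma> * real (card A) * ?L + real (card A) * real (card B)"
      unfolding R(5) A(2) by (rule L(3))
  qed
  ultimately have "?\<rho> \<le> Q - ?\<sigma> * (sum y A)\<^sup>2 + ?L * 1"
    unfolding R(4) Q_def y(2) by linarith
  then show False using Q neg by linarith
qed

end

text \<open>All estimates with one threshold. The two crude lower bounds for \<open>S\<close> serve
  to turn absolute into relative errors.\<close>

lemma extremal_bounds:
  fixes F :: "'a pair_pre_digraph" and \<epsilon> :: real
  assumes F: "pair_graph F" and chi: "chromatic_number F = r + 1" and r: "r + 1 \<ge> 4"
    and a: "indep_reduction F = 1" and \<epsilon>: "0 < \<epsilon>"
  shows "\<exists>N. \<forall>n \<Delta>. N \<le> n \<longrightarrow> \<Delta> < n \<longrightarrow> (n - \<Delta>) * (r - 1) \<le> \<Delta> \<longrightarrow>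
    \<bar>real (ex_deg F n \<Delta>) - real (num_edges (S_graph r n \<Delta>))\<bar> \<le> \<epsilon> * real n ^ 2 \<and>
    \<bar>spex_deg F n \<Delta> - graph_rho (S_graph r n \<Delta>)\<bar> \<le> \<epsilon> * real n \<and>
    real n ^ 2 / 32 \<le> real (num_edges (S_graph r n \<Delta>)) \<and> real n / 8 \<le> graph_rho (S_graph r n \<Delta>)"
proof -
  define p where "p = r - 1"
  have p: "p = r - 1" "1 \<le> p" "2 \<le> p" "r = Suc p" using r by (auto simp: p_def)
  have chi': "chromatic_number F = Suc p + 1" using chi p(4) by simp
  \<comment> \<open>\<open>graph_rho_upper\<close> multiplies this by 16: half of
    \<open>\<epsilon> * n\<close> goes to that error, the other half to the 1 lost in
    \<open>graph_rho_S_ge\<close>.\<close>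
  define \<eta> where "\<eta> = \<epsilon> / 32"
  have \<eta>: "0 < \<eta>" using \<epsilon> by (simp add: \<eta>_def)
  from sparse_neighbourhood[OF F chi' a p(2) \<eta>]
  obtain N0 where N0: "\<forall>n \<Delta> G. N0 \<le> \<Delta> \<longrightarrow> 0 < n \<longrightarrow> G \<in> free_graphs F n \<Delta> \<longrightarrow>
    (\<exists>A\<subseteq>{..<n}. card A = \<Delta> \<and> (\<forall>y. (\<forall>v\<in>A. 0 \<le> y v \<and> y v \<le> 1) \<longrightarrow>
      (\<Sum>u\<in>A. \<Sum>v\<in>A. if (u, v) \<in> parcs G then y u * y v else 0)
        \<le> (1 - 1 / real p) * (sum y A)\<^sup>2 + \<eta> * real \<Delta> ^ 2))"
    by (elim exE)
  \<comment> \<open>As \<open>n \<le> 2 * \<Delta>\<close>, the first summand gives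
    \<open>N0 \<le> \<Delta>\<close>; 16 serves the two lower bounds, and
    \<open>2 / \<epsilon>\<close> absorbs the rounding losses.\<close>
  define N where "N = 2 * N0 + 16 + nat \<lceil>2 / \<epsilon>\<rceil>"
  show ?thesis
  proof (intro exI[of _ N] allI impI)
    fix n \<Delta> assume n: "N \<le> n" and \<Delta>: "\<Delta> < n" "(n - \<Delta>) * (r - 1) \<le> \<Delta>"
    note \<Delta> = \<Delta>[folded p_def]
    let ?S = "S_graph r n \<Delta>" and ?\<sigma> = "1 - 1 / real p" and ?L = "join_rho p n \<Delta>"
    have "(n - \<Delta>) * 1 \<le> (n - \<Delta>) * p" using p(3) by (intro mult_le_mono) auto
    then have n2: "n \<le> 2 * \<Delta>" using \<Delta> by linarith
    have n0: "0 < n" "16 \<le> n" "N0 \<le> \<Delta>" "0 < \<Delta>" using n n2 by (auto simp: N_def)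
    have "2 / \<epsilon> \<le> real n" using n unfolding N_def by linarith
    then have n\<epsilon>: "2 \<le> \<epsilon> * real n" using \<epsilon> by (simp add: pos_divide_le_eq mult.commute)
    have n2': "real n \<le> 2 * real \<Delta>" "real \<Delta> \<le> real n" using n2 \<Delta> by simp_all
    have \<sigma>: "1 / 2 \<le> ?\<sigma>" using p(3) by (simp add: field_simps)
    have "2 * real n \<le> \<epsilon> * real n * real n" using mult_right_mono[OF n\<epsilon>, of "real n"] by simp
    then have n\<epsilon>2: "2 * real n \<le> \<epsilon> * real n ^ 2" by (simp add: power2_eq_square mult.assoc)
    have \<eta>n: "\<eta> * real \<Delta> ^ 2 \<le> \<epsilon> / 32 * real n ^ 2"
      unfolding \<eta>_def using \<epsilon> n2' by (intro mult_left_mono power_mono) auto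
    have S: "?S \<in> free_graphs F n \<Delta>" by (rule S_in_free_graphs[OF chi p(1,2) \<Delta>])
    have eS: "2 * real (n - \<Delta>) * real \<Delta> + ?\<sigma> * real \<Delta> ^ 2 - real \<Delta> \<le> 2 * real (num_edges ?S)"
      by (rule num_edges_S[OF p(1,2) \<Delta>])
    have rS: "?L - 1 \<le> graph_rho ?S" by (rule graph_rho_S_ge[OF p(1,2) n0(4) \<Delta>])
    have upper: "2 * real (num_edges G) \<le> ?\<sigma> * real \<Delta> ^ 2 + \<eta> * real \<Delta> ^ 2 + 2 * (real (n - \<Delta>) * real \<Delta>)"
      "graph_rho G \<le> ?L + 16 * \<eta> * real n" if G: "G \<in> free_graphs F n \<Delta>" for G
    proof -
      have pG: "pair_graph G" "pverts G = {..<n}" using G by (auto simp: free_graphs_def)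
      obtain A where A: "A \<subseteq> {..<n}" "card A = \<Delta>"
        and sp: "\<forall>y. (\<forall>v\<in>A. 0 \<le> y v \<and> y v \<le> 1) \<longrightarrow>
          (\<Sum>u\<in>A. \<Sum>v\<in>A. if (u, v) \<in> parcs G then y u * y v else 0)
            \<le> ?\<sigma> * (sum y A)\<^sup>2 + \<eta> * real \<Delta> ^ 2"
        using N0[rule_format, OF n0(3,1) G] by (elim exE conjE)
      have sp': "(\<Sum>u\<in>A. \<Sum>v\<in>A. if (u, v) \<in> parcs G then y u * y v else 0)
            \<le> ?\<sigma> * (sum y A)\<^sup>2 + \<eta> * real \<Delta> ^ 2" if "\<And>v. v \<in> A \<Longrightarrow> 0 \<le> y v \<and> y v \<le> 1" for y
        by (rule sp[rule_format]) (rule that)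
      show "2 * real (num_edges G) \<le> ?\<sigma> * real \<Delta> ^ 2 + \<eta> * real \<Delta> ^ 2 + 2 * (real (n - \<Delta>) * real \<Delta>)"
        by (rule num_edges_upper[OF pG free_graphs_degree(1)[OF G n0(1)] A \<eta> \<Delta> p(3) sp'])
      show "graph_rho G \<le> ?L + 16 * \<eta> * real n"
        by (rule graph_rho_upper[OF pG free_graphs_degree(1)[OF G n0(1)] A \<eta> \<Delta> p(3) sp'])
    qed
    have fin: "finite (num_edges ` free_graphs F n \<Delta>)" "finite (graph_rho ` free_graphs F n \<Delta>)"
      by (intro finite_imageI finite_free_graphs)+
    have ex_ge: "num_edges ?S \<le> ex_deg F n \<Delta>" and spex_ge: "graph_rho ?S \<le> spex_deg F n \<Delta>"
      unfolding ex_deg_def spex_deg_def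
      by (rule Max_ge[OF fin(1) imageI[OF S]], rule Max_ge[OF fin(2) imageI[OF S]])
    \<comment> \<open>\<open>S\<close> witnesses nonemptiness, so that both maxima are
      attained.\<close>
    have ne: "num_edges ` free_graphs F n \<Delta> \<noteq> {}" "graph_rho ` free_graphs F n \<Delta> \<noteq> {}"
      using S by blast+
    obtain G1 where "ex_deg F n \<Delta> = num_edges G1" "G1 \<in> free_graphs F n \<Delta>"
      using Max_in[OF fin(1) ne(1)] unfolding ex_deg_def by (rule imageE)
    then have ex_le: "2 * real (ex_deg F n \<Delta>) \<le> ?\<sigma> * real \<Delta> ^ 2 + \<eta> * real \<Delta> ^ 2 + 2 * (real (n - \<Delta>) * real \<Delta>)"
      using upper(1)[of G1] by simp
    obtain G2 where "spex_deg F n \<Delta> = graph_rho G2" "G2 \<in> free_graphs F n \<Delta>"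
      using Max_in[OF fin(2) ne(2)] unfolding spex_deg_def by (rule imageE)
    then have spex_le: "spex_deg F n \<Delta> \<le> ?L + 16 * \<eta> * real n"
      using upper(2)[of G2] by simp
    have 1: "\<bar>real (ex_deg F n \<Delta>) - real (num_edges ?S)\<bar> \<le> \<epsilon> * real n ^ 2"
    proof -
      have "real (num_edges ?S) \<le> real (ex_deg F n \<Delta>)" using ex_ge by simp
      moreover have "0 \<le> \<epsilon> * real n ^ 2" using \<epsilon> by simp
      ultimately show ?thesis using ex_le eS \<eta>n n2' n\<epsilon>2 by linarith
    qed
    have "16 * \<eta> * real n = \<epsilon> * real n / 2" by (simp add: \<eta>_def)
    then have 2: "\<bar>spex_deg F n \<Delta> - graph_rho ?S\<bar> \<le> \<epsilon> * real n"
      using spex_ge spex_le rS n\<epsilon> by linarith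
    have 3: "real n ^ 2 / 32 \<le> real (num_edges ?S)"
    proof -
      have "1 / 2 * real \<Delta> ^ 2 \<le> ?\<sigma> * real \<Delta> ^ 2" using \<sigma> by (rule mult_right_mono) simp
      moreover have "real n ^ 2 \<le> (2 * real \<Delta>) ^ 2" using n2' by (intro power_mono) auto
      then have "real n ^ 2 \<le> 4 * real \<Delta> ^ 2" by (simp add: power_mult_distrib)
      moreover have "16 * real n \<le> real n ^ 2"
        using n0(2) by (simp add: power2_eq_square)
      moreover have "0 \<le> 2 * real (n - \<Delta>) * real \<Delta>" by simp
      moreover have "2 * real \<Delta> \<le> 2 * real n" using n2' by simp
      ultimately show ?thesis using eS by linarith
    qed
    have 4: "real n / 8 \<le> graph_rho ?S"
    proof -
      have "1 / 2 * real \<Delta> \<le> ?\<sigma> * real \<Delta>" using \<sigma> by (rule mult_right_mono) simp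
      then have "real n / 4 \<le> ?L" using join_rho(2)[OF p(2) n0(4) \<Delta>(1)] n2' by linarith
      moreover have "16 \<le> real n" using n0(2) by simp
      ultimately show ?thesis using rS by linarith
    qed
    show "\<bar>real (ex_deg F n \<Delta>) - real (num_edges ?S)\<bar> \<le> \<epsilon> * real n ^ 2 \<and>
      \<bar>spex_deg F n \<Delta> - graph_rho ?S\<bar> \<le> \<epsilon> * real n \<and>
      real n ^ 2 / 32 \<le> real (num_edges ?S) \<and> real n / 8 \<le> graph_rho ?S"
      by (intro conjI 1 2 3 4)
  qed
qed

section \<open>Passage to uniform asymptotics\<close>

lemma eventually_uniform_filter:
  assumes r: "1 \<le> r"
    and P: "\<And>n \<Delta>. N \<le> n \<Longrightarrow> \<Delta> < n \<Longrightarrow> (n - \<Delta>) * (r - 1) \<le> \<Delta> \<Longrightarrow> P n \<Delta>"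
  shows "\<forall>\<^sub>F (n, \<Delta>) in uniform_filter r. P n \<Delta>"
proof -
  \<comment> \<open>Clearing denominators: \<open>(r - 1) * n \<le> r * \<Delta>\<close> rearranges
    to the condition on natural numbers.\<close>
  have adm: "(n - \<Delta>) * (r - 1) \<le> \<Delta>" if "\<lceil>(real r - 1) * real n / real r\<rceil> \<le> int \<Delta>" for n \<Delta>
  proof -
    have "(real r - 1) * real n / real r \<le> real \<Delta>" using that by (simp add: ceiling_le_iff)
    then have "(real r - 1) * real n \<le> real \<Delta> * real r" using r by (simp add: pos_divide_le_eq)
    then have "real ((r - 1) * n) \<le> real (\<Delta> * r)" using r by (simp add: of_nat_diff)
    then have "n * (r - 1) \<le> \<Delta> * r" by (simp only: of_nat_le_iff mult.commute)
    moreover have "\<Delta> * r = \<Delta> * (r - 1) + \<Delta>" using r by (simp add: algebra_simps)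
    ultimately show ?thesis by (simp add: diff_mult_distrib)
  qed
  show ?thesis
    unfolding uniform_filter_def eventually_inf_principal eventually_filtercomap
    by (intro exI[of _ "\<lambda>n. N \<le> n"] conjI eventually_ge_at_top) (auto intro!: P adm)
qed

text \<open>As \<open>b\<close> is at least a fixed multiple of \<open>g\<close>, an error small
  against \<open>g\<close> is small against \<open>b\<close>; the relative error
  \<open>(a - b) / b\<close> is the witness \<open>h\<close>.\<close>

lemma smallo_diff_imp_asymp_factor:
  fixes a b g :: "'b \<Rightarrow> real"
  assumes small: "\<And>\<epsilon>. 0 < \<epsilon> \<Longrightarrow> \<forall>\<^sub>F x in Fl. \<bar>a x - b x\<bar> \<le> \<epsilon> * g x"
    and lower: "\<forall>\<^sub>F x in Fl. 0 < g x \<and> \<kappa> * g x \<le> b x" and \<kappa>: "0 < \<kappa>"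
  shows "(\<lambda>x. a x - b x) \<in> o[Fl](g)"
    and "\<exists>h\<in>o[Fl](\<lambda>_. 1 :: real). \<forall>\<^sub>F x in Fl. a x = (1 + h x) * b x"
proof -
  show "(\<lambda>x. a x - b x) \<in> o[Fl](g)"
  proof (rule landau_o.smallI)
    fix c :: real assume "0 < c"
    from small[OF this] lower show "\<forall>\<^sub>F x in Fl. norm (a x - b x) \<le> c * norm (g x)"
      by eventually_elim simp
  qed
  have "(\<lambda>x. (a x - b x) / b x) \<in> o[Fl](\<lambda>_. 1 :: real)"
  proof (rule landau_o.smallI)
    fix c :: real assume c: "0 < c"
    then have "0 < c * \<kappa>" using \<kappa> by simp
    from small[OF this] lower show "\<forall>\<^sub>F x in Fl. norm ((a x - b x) / b x) \<le> c * norm (1 :: real)"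
    proof eventually_elim
      case (elim x)
      have "0 < \<kappa> * g x" using elim \<kappa> by simp
      then have b: "0 < b x" using elim by linarith
      have "\<bar>a x - b x\<bar> \<le> c * (\<kappa> * g x)" using elim by (simp add: mult.assoc)
      also have "\<dots> \<le> c * b x" using elim c by (intro mult_left_mono) auto
      finally show ?case using b by (simp add: abs_divide pos_divide_le_eq)
    qed
  qed
  moreover have "\<forall>\<^sub>F x in Fl. a x = (1 + (a x - b x) / b x) * b x"
    using lower
  proof eventually_elim
    case (elim x)
    have "0 < \<kappa> * g x" using elim \<kappa> by simp
    then have "b x \<noteq> 0" using elim by linarith
    then show ?case by (simp add: field_simps)
  qed
  ultimately show "\<exists>h\<in>o[Fl](\<lambda>_. 1 :: real). \<forall>\<^sub>F x in Fl. a x = (1 + h x) * b x"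
    by (rule bexI[where x = "\<lambda>x. (a x - b x) / b x", rotated])
qed

theorem corollary1p8:
  fixes F :: "'a pair_pre_digraph" and r :: nat
  assumes "pair_graph F"
    and "chromatic_number F = r + 1"
    and "r + 1 \<ge> 4"
    and "indep_reduction F = 1"
  shows
    "(\<lambda>(n, \<Delta>). real (ex_deg F n \<Delta>) - real (num_edges (S_graph r n \<Delta>)))
        \<in> o[uniform_filter r](\<lambda>(n, \<Delta>). real n ^ 2)
     \<and> (\<exists>h \<in> o[uniform_filter r](\<lambda>_. 1 :: real).
          \<forall>\<^sub>F (n, \<Delta>) in uniform_filter r.
            real (ex_deg F n \<Delta>) = (1 + h (n, \<Delta>)) * real (num_edges (S_graph r n \<Delta>)))
     \<and> (\<lambda>(n, \<Delta>). spex_deg F n \<Delta> - graph_rho (S_graph r n \<Delta>))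
        \<in> o[uniform_filter r](\<lambda>(n, \<Delta>). real n)
     \<and> (\<exists>h \<in> o[uniform_filter r](\<lambda>_. 1 :: real).
          \<forall>\<^sub>F (n, \<Delta>) in uniform_filter r.
            spex_deg F n \<Delta> = (1 + h (n, \<Delta>)) * graph_rho (S_graph r n \<Delta>))"
proof -
  define ex where "ex = (\<lambda>(n, \<Delta>). real (ex_deg F n \<Delta>))"
  define eS where "eS = (\<lambda>(n, \<Delta>). real (num_edges (S_graph r n \<Delta>)))"
  define sp where "sp = (\<lambda>(n, \<Delta>). spex_deg F n \<Delta>)"
  define rS where "rS = (\<lambda>(n, \<Delta>). graph_rho (S_graph r n \<Delta>))"
  define g2 where "g2 = (\<lambda>(n, \<Delta> :: nat). real n ^ 2)"
  define g1 where "g1 = (\<lambda>(n, \<Delta> :: nat). real n)"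
  note defs = ex_def eS_def sp_def rS_def g2_def g1_def
  have r: "1 \<le> r" using assms(3) by simp
  have bounds: "\<forall>\<^sub>F x in uniform_filter r. \<bar>ex x - eS x\<bar> \<le> \<epsilon> * g2 x \<and> \<bar>sp x - rS x\<bar> \<le> \<epsilon> * g1 x
      \<and> (0 < g2 x \<and> 1 / 32 * g2 x \<le> eS x) \<and> (0 < g1 x \<and> 1 / 8 * g1 x \<le> rS x)" if \<epsilon>: "0 < \<epsilon>" for \<epsilon>
  proof -
    obtain N where N: "\<forall>n \<Delta>. N \<le> n \<longrightarrow> \<Delta> < n \<longrightarrow> (n - \<Delta>) * (r - 1) \<le> \<Delta> \<longrightarrow>
      \<bar>real (ex_deg F n \<Delta>) - real (num_edges (S_graph r n \<Delta>))\<bar> \<le> \<epsilon> * real n ^ 2 \<and>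
      \<bar>spex_deg F n \<Delta> - graph_rho (S_graph r n \<Delta>)\<bar> \<le> \<epsilon> * real n \<and>
      real n ^ 2 / 32 \<le> real (num_edges (S_graph r n \<Delta>)) \<and> real n / 8 \<le> graph_rho (S_graph r n \<Delta>)"
      using extremal_bounds[OF assms \<epsilon>] by (elim exE)
    have "\<forall>\<^sub>F (n, \<Delta>) in uniform_filter r.
      \<bar>ex (n, \<Delta>) - eS (n, \<Delta>)\<bar> \<le> \<epsilon> * g2 (n, \<Delta>) \<and> \<bar>sp (n, \<Delta>) - rS (n, \<Delta>)\<bar> \<le> \<epsilon> * g1 (n, \<Delta>)
      \<and> (0 < g2 (n, \<Delta>) \<and> 1 / 32 * g2 (n, \<Delta>) \<le> eS (n, \<Delta>))
      \<and> (0 < g1 (n, \<Delta>) \<and> 1 / 8 * g1 (n, \<Delta>) \<le> rS (n, \<Delta>))"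
    proof (rule eventually_uniform_filter[OF r, where N = N])
      fix n \<Delta> assume "N \<le> n" "\<Delta> < n" "(n - \<Delta>) * (r - 1) \<le> \<Delta>"
      with N[rule_format, OF this] show "\<bar>ex (n, \<Delta>) - eS (n, \<Delta>)\<bar> \<le> \<epsilon> * g2 (n, \<Delta>)
        \<and> \<bar>sp (n, \<Delta>) - rS (n, \<Delta>)\<bar> \<le> \<epsilon> * g1 (n, \<Delta>)
        \<and> (0 < g2 (n, \<Delta>) \<and> 1 / 32 * g2 (n, \<Delta>) \<le> eS (n, \<Delta>))
        \<and> (0 < g1 (n, \<Delta>) \<and> 1 / 8 * g1 (n, \<Delta>) \<le> rS (n, \<Delta>))"
        unfolding defs by simp
    qed
    then show ?thesis by (simp add: case_prod_unfold)
  qed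
  have A: "\<forall>\<^sub>F x in uniform_filter r. \<bar>ex x - eS x\<bar> \<le> \<epsilon> * g2 x" if "0 < \<epsilon>" for \<epsilon>
    using bounds[OF that] by (rule eventually_mono) blast
  have B: "\<forall>\<^sub>F x in uniform_filter r. \<bar>sp x - rS x\<bar> \<le> \<epsilon> * g1 x" if "0 < \<epsilon>" for \<epsilon>
    using bounds[OF that] by (rule eventually_mono) blast
  \<comment> \<open>The lower bounds do not involve \<open>\<epsilon>\<close>, so any positive value
    does.\<close>
  have A': "\<forall>\<^sub>F x in uniform_filter r. 0 < g2 x \<and> 1 / 32 * g2 x \<le> eS x"
    by (rule eventually_mono[OF bounds[of 1]]) simp_all
  have B': "\<forall>\<^sub>F x in uniform_filter r. 0 < g1 x \<and> 1 / 8 * g1 x \<le> rS x"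
    by (rule eventually_mono[OF bounds[of 1]]) simp_all
  note E = smallo_diff_imp_asymp_factor[OF A A', simplified]
  note R = smallo_diff_imp_asymp_factor[OF B B', simplified]
  show ?thesis
    using E R unfolding defs by (simp add: case_prod_unfold)
qed

end
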